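(* Let $A$ be a supercyclic Banach algebra of dimension $>1$. Then $A$ is infinite dimensional, radical and weakly amenable.
   Context: A Banach algebra is a complex algebra $A$, possibly without unit, equipped with a complete norm satisfying $\|ab\|\le\|a\|\,\|b\|$. $A$ is supercyclic if there is $a\in A$ such that $\{za^n: z\in\mathbb C,\ n\in\mathbb N\}$ is dense in $A$ ($\mathbb N$ = positive integers). $A$ is radical if it coincides with its Jacobson radical. $A$ is weakly amenable if every continuous derivation $D:A\to A^*$ (i.e. $D(ab)=(Da)b+a(Db)$, with the natural Banach $A$-bimodule structure on the dual $A^*$) has the form $Da=ax-xa$ for some $x\in A^*$. *)

theory Defs
  imports "HOL-Analysis.Analysis"
begin

text \<open>A complex Banach algebra (possibly without unit) is modelled as a type
  'a of class real_normed_algebra and banach (associative, submultiplicative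
  complete norm, real scalars) together with a complex scalar multiplication
  sc extending the real one, compatible with the vector space, algebra
  and norm structure.\<close>

definition complex_banach_algebra :: "(complex \<Rightarrow> 'a::{real_normed_algebra,banach} \<Rightarrow> 'a) \<Rightarrow> bool" where
  "complex_banach_algebra sc \<longleftrightarrow>
     (\<forall>r x. sc (complex_of_real r) x = scaleR r x) \<and>
     (\<forall>z w x. sc (z * w) x = sc z (sc w x)) \<and>
     (\<forall>z w x. sc (z + w) x = sc z x + sc w x) \<and>
     (\<forall>z x y. sc z (x + y) = sc z x + sc z y) \<and>
     (\<forall>z x. norm (sc z x) = cmod z * norm x) \<and>
     (\<forall>z x y. sc z (x * y) = sc z x * y) \<and>
     (\<forall>z x y. sc z (x * y) = x * sc z y)"

text \<open>Positive powers in a possibly non-unital algebra: apow a n = a^n for n >= 1.\<close>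
fun apow :: "'a::times \<Rightarrow> nat \<Rightarrow> 'a" where
  "apow a 0 = a"   (* unused junk value *)
| "apow a (Suc 0) = a"
| "apow a (Suc (Suc n)) = a * apow a (Suc n)"

definition cspan :: "(complex \<Rightarrow> 'a \<Rightarrow> 'a) \<Rightarrow> 'a set \<Rightarrow> 'a::ab_group_add set" where
  "cspan sc S = {(\<Sum>v\<in>S. sc (c v) v) | c. True}"

definition cdim_le_1 :: "(complex \<Rightarrow> 'a \<Rightarrow> 'a) \<Rightarrow> bool" where
  "cdim_le_1 sc \<longleftrightarrow> (\<exists>v. \<forall>x. \<exists>z. x = sc z v)"

definition cfinite_dimensional :: "(complex \<Rightarrow> 'a \<Rightarrow> 'a::ab_group_add) \<Rightarrow> bool" where
  "cfinite_dimensional sc \<longleftrightarrow> (\<exists>S. finite S \<and> cspan sc S = UNIV)"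

definition supercyclic :: "(complex \<Rightarrow> 'a \<Rightarrow> 'a::{real_normed_algebra}) \<Rightarrow> bool" where
  "supercyclic sc \<longleftrightarrow> (\<exists>a. closure {sc z (apow a n) | z n. n \<ge> 1} = UNIV)"

definition left_ideal :: "(complex \<Rightarrow> 'a \<Rightarrow> 'a::real_normed_algebra) \<Rightarrow> 'a set \<Rightarrow> bool" where
  "left_ideal sc L \<longleftrightarrow> 0 \<in> L \<and> (\<forall>x\<in>L. \<forall>y\<in>L. x + y \<in> L) \<and>
     (\<forall>z. \<forall>x\<in>L. sc z x \<in> L) \<and> (\<forall>a. \<forall>x\<in>L. a * x \<in> L)"

definition modular_left_ideal :: "(complex \<Rightarrow> 'a \<Rightarrow> 'a::real_normed_algebra) \<Rightarrow> 'a set \<Rightarrow> bool" where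
  "modular_left_ideal sc L \<longleftrightarrow> left_ideal sc L \<and> (\<exists>u. \<forall>a. a - a * u \<in> L)"

definition maximal_modular_left_ideal :: "(complex \<Rightarrow> 'a \<Rightarrow> 'a::real_normed_algebra) \<Rightarrow> 'a set \<Rightarrow> bool" where
  "maximal_modular_left_ideal sc L \<longleftrightarrow> modular_left_ideal sc L \<and> L \<noteq> UNIV \<and>
     (\<forall>M. left_ideal sc M \<and> L \<subseteq> M \<and> M \<noteq> UNIV \<longrightarrow> M = L)"

definition jacobson_radical :: "(complex \<Rightarrow> 'a \<Rightarrow> 'a::real_normed_algebra) \<Rightarrow> 'a set" where
  "jacobson_radical sc = {a. \<forall>L. maximal_modular_left_ideal sc L \<longrightarrow> a \<in> L}"

definition radical_algebra :: "(complex \<Rightarrow> 'a \<Rightarrow> 'a::real_normed_algebra) \<Rightarrow> bool" where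
  "radical_algebra sc \<longleftrightarrow> jacobson_radical sc = UNIV"

definition dual_elem :: "(complex \<Rightarrow> 'a \<Rightarrow> 'a::real_normed_algebra) \<Rightarrow> ('a \<Rightarrow> complex) \<Rightarrow> bool" where
  "dual_elem sc f \<longleftrightarrow> (\<forall>x y. f (x + y) = f x + f y) \<and> (\<forall>z x. f (sc z x) = z * f x) \<and>
     (\<exists>K. \<forall>x. cmod (f x) \<le> K * norm x)"

text \<open>Continuous derivations D : A \<rightarrow> A*, with D a represented as the functional
  D a.  Module actions: (a . f)(x) = f(x a), (f . a)(x) = f(a x).
  Continuity of the linear map D : A \<rightarrow> A* (dual norm) is written out as the
  bound |D a x| \<le> K \<parallel>a\<parallel> \<parallel>x\<parallel>.\<close>
definition continuous_derivation_dual :: "(complex \<Rightarrow> 'a \<Rightarrow> 'a::real_normed_algebra) \<Rightarrow> ('a \<Rightarrow> 'a \<Rightarrow> complex) \<Rightarrow> bool" where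
  "continuous_derivation_dual sc D \<longleftrightarrow>
     (\<forall>a. dual_elem sc (D a)) \<and>
     (\<forall>a b. D (a + b) = (\<lambda>x. D a x + D b x)) \<and>
     (\<forall>z a. D (sc z a) = (\<lambda>x. z * D a x)) \<and>
     (\<exists>K. \<forall>a x. cmod (D a x) \<le> K * norm a * norm x) \<and>
     (\<forall>a b x. D (a * b) x = D a (b * x) + D b (x * a))"

definition weakly_amenable :: "(complex \<Rightarrow> 'a \<Rightarrow> 'a::real_normed_algebra) \<Rightarrow> bool" where
  "weakly_amenable sc \<longleftrightarrow>
     (\<forall>D. continuous_derivation_dual sc D \<longrightarrow>
        (\<exists>f. dual_elem sc f \<and> (\<forall>a x. D a x = f (x * a) - f (a * x))))"

end

theory Submission
  imports Defs
begin

text \<open>Density of the lines spanned by the powers of the supercyclic element \<open>a\<close> makes the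
  algebra commutative and its spectral radius \<open>r\<close> multiplicative. If \<open>r(a) > 0\<close>, Ostrowski's proof
  of the Gelfand-Mazur theorem gives, after rescaling, \<open>r(a\<^sup>2 - a) = 0\<close>; a binomial series then
  produces an idempotent \<open>e\<close> with \<open>r(e - a) = 0\<close>, density forces \<open>e\<close> to be a unit, and since some
  power \<open>a\<^sup>n\<close> is close to \<open>e\<close>, so is its unique \<open>n\<close>-th root \<open>a\<close> with \<open>r(a - e) = 0\<close>. Hence \<open>a = e\<close>
  and the dimension is at most one. In larger dimension every element is therefore quasinilpotent,
  which leaves no proper modular ideal and excludes finite dimension. A continuous derivation
  satisfies \<open>m D(a\<^sup>n)(a\<^sup>m) = n D(a\<^sup>m)(a\<^sup>n)\<close>, and letting \<open>n\<close> grow shows that it vanishes.\<close>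

section \<open>Powers and the spectral radius\<close>

lemma apow_Suc: "n \<ge> 1 \<Longrightarrow> apow a (Suc n) = a * apow a n"
  by (cases n) auto

lemma apow_add:
  fixes a :: "'a::semigroup_mult"
  assumes "m \<ge> 1" "n \<ge> 1"
  shows "apow a m * apow a n = apow a (m + n)"
  using assms(1)
proof (induction m rule: dec_induct)
  case base
  show ?case using assms(2) by (simp add: apow_Suc)
next
  case (step k)
  then show ?case using assms(2) by (simp add: apow_Suc mult.assoc)
qed

lemma apow_funpow: "apow a (Suc n) = ((*) a ^^ n) a"
  by (induction n) (auto simp: apow_Suc)

lemma funpow_mult_apow:
  fixes a :: "'a::semigroup_mult"
  assumes "n \<ge> 1"
  shows "((*) a ^^ n) v = apow a n * v"
  using assms
proof (induction n rule: dec_induct)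
  case base
  show ?case by simp
next
  case (step k)
  then show ?case by (simp add: apow_Suc mult.assoc)
qed

lemma norm_funpow_mult_le:
  fixes x :: "'a::real_normed_algebra"
  shows "norm (((*) x ^^ n) v) \<le> norm x ^ n * norm v"
proof (induction n)
  case (Suc n)
  have "norm (((*) x ^^ Suc n) v) \<le> norm x * norm (((*) x ^^ n) v)"
    by (simp add: norm_mult_ineq)
  also have "\<dots> \<le> norm x * (norm x ^ n * norm v)"
    by (intro mult_left_mono Suc) auto
  finally show ?case by (simp add: mult.assoc)
qed simp

text \<open>Powers act by multiplication, so that the zeroth power makes sense without a unit.\<close>

definition geom_bounded :: "'a::real_normed_algebra \<Rightarrow> real \<Rightarrow> bool" where
  "geom_bounded x c \<longleftrightarrow> c > 0 \<and> (\<exists>C. \<forall>n v. norm (((*) x ^^ n) v) \<le> C * c ^ n * norm v)"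

text \<open>Gelfand's limit of the n-th roots of \<open>norm (apow x n)\<close>, encoded as an
  infimum of geometric growth rates so that it makes sense without a spectrum or a unit.\<close>

definition spectral_radius :: "'a::real_normed_algebra \<Rightarrow> real" where
  "spectral_radius x = Inf {c. geom_bounded x c}"

lemma geom_boundedE:
  fixes x :: "'a::real_normed_algebra"
  assumes "geom_bounded x c"
  obtains C where "C > 0" "\<And>n v. norm (((*) x ^^ n) v) \<le> C * c ^ n * norm v"
proof -
  from assms obtain C where c: "c > 0" and C: "\<And>n v. norm (((*) x ^^ n) v) \<le> C * c ^ n * norm v"
    unfolding geom_bounded_def by blast
  show ?thesis
  proof (rule that[of "\<bar>C\<bar> + 1"])
    fix n :: nat and v :: 'a
    have "C * (c ^ n * norm v) \<le> (\<bar>C\<bar> + 1) * (c ^ n * norm v)"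
      using c by (intro mult_right_mono) auto
    with C[of n v] show "norm (((*) x ^^ n) v) \<le> (\<bar>C\<bar> + 1) * c ^ n * norm v"
      by (simp add: mult.assoc)
  qed simp
qed

lemma geom_bounded_norm:
  fixes x :: "'a::real_normed_algebra"
  shows "c > 0 \<Longrightarrow> norm x \<le> c \<Longrightarrow> geom_bounded x c"
  unfolding geom_bounded_def
proof (intro conjI exI[of _ 1] allI)
  fix n :: nat and v :: 'a assume "norm x \<le> c"
  then have "norm x ^ n * norm v \<le> c ^ n * norm v"
    by (intro mult_right_mono power_mono) auto
  with norm_funpow_mult_le[of n x v] show "norm (((*) x ^^ n) v) \<le> 1 * c ^ n * norm v"
    by simp
qed

lemma geom_bounded_mono:
  assumes "geom_bounded x c" "c \<le> d"
  shows "geom_bounded x d"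
proof -
  obtain C where C: "C > 0" "\<And>n v. norm (((*) x ^^ n) v) \<le> C * c ^ n * norm v"
    using geom_boundedE[OF assms(1)] by metis
  have c: "c > 0" using assms(1) by (simp add: geom_bounded_def)
  have "norm (((*) x ^^ n) v) \<le> C * d ^ n * norm v" for n v
  proof -
    have "C * c ^ n * norm v \<le> C * d ^ n * norm v"
      using C(1) c assms(2) by (intro mult_right_mono mult_left_mono power_mono) auto
    with C(2)[of n v] show ?thesis by linarith
  qed
  then show ?thesis using c assms(2) unfolding geom_bounded_def by auto
qed

lemma bdd_below_geom_bounded: "bdd_below {c. geom_bounded x c}"
  by (rule bdd_belowI[of _ 0]) (auto simp: geom_bounded_def)

lemma geom_bounded_nonempty: "{c. geom_bounded x c} \<noteq> {}"
  using geom_bounded_norm[of "norm x + 1" x] by (auto simp: add_nonneg_pos)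

lemma spectral_radius_le: "geom_bounded x c \<Longrightarrow> spectral_radius x \<le> c"
  unfolding spectral_radius_def by (rule cInf_lower) (auto intro: bdd_below_geom_bounded)

lemma spectral_radius_nonneg [simp]: "spectral_radius x \<ge> 0"
  unfolding spectral_radius_def
  by (rule cInf_greatest[OF geom_bounded_nonempty]) (auto simp: geom_bounded_def)

lemma geom_bounded_if_spectral_radius_less:
  assumes "spectral_radius x < c"
  shows "geom_bounded x c"
proof -
  obtain d where "geom_bounded x d" "d < c"
    using cInf_lessD[OF geom_bounded_nonempty assms[unfolded spectral_radius_def]] by auto
  then show ?thesis by (auto intro: geom_bounded_mono)
qed

lemma spectral_radius_leI:
  assumes "\<And>c. c > b \<Longrightarrow> geom_bounded x c"
  shows "spectral_radius x \<le> b"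
  by (rule dense_ge) (auto intro: spectral_radius_le assms)

lemma spectral_radius_le_norm: "spectral_radius x \<le> norm x"
proof (rule spectral_radius_leI, rule geom_bounded_norm)
  fix c assume "c > norm x"
  then show "c > 0" by (rule le_less_trans[OF norm_ge_zero])
qed simp

lemma spectral_radius_zero [simp]: "spectral_radius 0 = 0"
  by (rule antisym) (use spectral_radius_le_norm[of 0] in auto)

lemma apow_geom_bound:
  assumes "spectral_radius y < d"
  obtains C where "C > 0" "\<And>n. n \<ge> 1 \<Longrightarrow> norm (apow y n) \<le> C * d ^ n"
proof -
  have g: "geom_bounded y d" by (rule geom_bounded_if_spectral_radius_less[OF assms])
  then have d: "d > 0" by (simp add: geom_bounded_def)
  obtain C where C: "C > 0" "\<And>n v. norm (((*) y ^^ n) v) \<le> C * d ^ n * norm v"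
    using geom_boundedE[OF g] by metis
  show ?thesis
  \<comment> \<open>\<open>apow y n\<close> arises from \<open>y\<close> by n - 1 multiplications,
    hence the division by \<open>d\<close>; the summand 1 keeps the constant positive for
    \<open>y = 0\<close>.\<close>
  proof (rule that[of "C * (norm y + 1) / d"])
    show "C * (norm y + 1) / d > 0" using C(1) d by (simp add: add_nonneg_pos)
    fix n :: nat assume "n \<ge> 1"
    then obtain k where n: "n = Suc k" by (cases n) auto
    have "norm (apow y n) \<le> C * d ^ k * norm y"
      unfolding n apow_funpow by (rule C(2))
    also have "\<dots> \<le> C * d ^ k * (norm y + 1)"
      using C(1) d by (intro mult_left_mono) auto
    also have "\<dots> = C * (norm y + 1) / d * d ^ n"
      using d by (simp add: n)
    finally show "norm (apow y n) \<le> C * (norm y + 1) / d * d ^ n" .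
  qed
qed

text \<open>Iterating \<open>w = w * j\<close> writes \<open>w\<close> as itself times arbitrarily
  high powers of \<open>j\<close>, which decay geometrically. This stands in for the invertibility
  of 1 - j.\<close>

lemma eq_0_if_quasinilpotent_eigen:
  fixes w :: "'a::real_normed_algebra"
  assumes "spectral_radius j = 0" and w: "w = w * j" and comm: "w * j = j * w"
  shows "w = 0"
proof -
  have "geom_bounded j (1/2)"
    using assms(1) by (intro geom_bounded_if_spectral_radius_less) auto
  then obtain C where C: "\<And>n v. norm (((*) j ^^ n) v) \<le> C * (1/2) ^ n * norm v"
    using geom_boundedE by metis
  have "((*) j ^^ n) w = w" for n
    by (induction n) (use w comm in auto)
  with C have le: "norm w \<le> C * (1/2) ^ n * norm w" for n
    by metis
  have "(\<lambda>n. C * (1/2) ^ n * norm w) \<longlonglongrightarrow> C * 0 * norm w"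
    by (intro tendsto_intros LIMSEQ_realpow_zero) auto
  then have "norm w \<le> C * 0 * norm w"
    by (rule LIMSEQ_le_const) (use le in auto)
  then show ?thesis by simp
qed

section \<open>Commutative complex Banach algebras\<close>

locale complex_banach_alg =
  fixes sc :: "complex \<Rightarrow> 'a::{real_normed_algebra,banach} \<Rightarrow> 'a"
  assumes cba: "complex_banach_algebra sc"
begin

lemma sc_of_real: "sc (of_real r) x = scaleR r x"
  and sc_sc: "sc z (sc w x) = sc (z * w) x"
  and sc_add_left: "sc (z + w) x = sc z x + sc w x"
  and sc_add_right: "sc z (x + y) = sc z x + sc z y"
  and norm_sc: "norm (sc z x) = cmod z * norm x"
  and mult_sc_left: "sc z x * y = sc z (x * y)"
  and mult_sc_right: "x * sc z y = sc z (x * y)"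
  using cba unfolding complex_banach_algebra_def by metis+

lemma sc_1 [simp]: "sc 1 x = x"
  using sc_of_real[of 1 x] by simp

lemma sc_0 [simp]: "sc 0 x = 0"
  using sc_of_real[of 0 x] by simp

lemma sc_zero [simp]: "sc z 0 = 0"
  using norm_sc[of z 0] by simp

lemma sc_minus_left: "sc (- z) x = - sc z x"
  using sc_add_left[of "- z" z x] by (simp add: eq_neg_iff_add_eq_0)

lemma sc_minus_right: "sc z (- x) = - sc z x"
  using sc_add_right[of z "- x" x] by (simp add: eq_neg_iff_add_eq_0)

lemma sc_diff_left: "sc (z - w) x = sc z x - sc w x"
  using sc_add_left[of z "- w" x] by (simp add: sc_minus_left)

lemma sc_diff_right: "sc z (x - y) = sc z x - sc z y"
  using sc_add_right[of z x "- y"] by (simp add: sc_minus_right)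

lemma apow_sc: "n \<ge> 1 \<Longrightarrow> apow (sc z x) n = sc (z ^ n) (apow x n)"
proof (induction n rule: dec_induct)
  case (step k)
  then show ?case
    by (simp add: apow_Suc mult_sc_left mult_sc_right sc_sc mult.commute)
qed simp

lemma bounded_linear_sc_left: "bounded_linear (\<lambda>z. sc z v)"
proof (rule bounded_linear_intro[of _ "norm v"])
  fix r z
  show "sc (scaleR r z) v = scaleR r (sc z v)"
    by (simp add: scaleR_conv_of_real sc_sc[symmetric] sc_of_real)
qed (simp_all add: sc_add_left norm_sc)

lemma bounded_linear_sc_right: "bounded_linear (sc z)"
proof (rule bounded_linear_intro[of _ "cmod z"])
  fix r x
  show "sc z (scaleR r x) = scaleR r (sc z x)"
    by (simp add: sc_of_real[symmetric] sc_sc mult.commute)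
qed (simp_all add: sc_add_right norm_sc)

text \<open>For nonzero \<open>v\<close> the parametrization multiplies norms by
  \<open>norm v\<close>, so the line is a complete copy of the plane.\<close>

lemma closed_line: "closed (range (\<lambda>z. sc z v))"
proof (cases "v = 0")
  case False
  show ?thesis
  proof (rule complete_imp_closed, rule complete_isometric_image[of "norm v"])
    show "\<forall>z\<in>UNIV. norm v * norm z \<le> norm (sc z v)" by (simp add: norm_sc)
    show "complete (UNIV :: complex set)" by (simp add: complete_UNIV)
  qed (use False bounded_linear_sc_left in auto)
qed (simp add: image_constant_conv)

lemma cdim_le_1_if_line_dense:
  assumes "\<And>x \<epsilon>. \<epsilon> > 0 \<Longrightarrow> \<exists>z. norm (x - sc z v) < \<epsilon>"
  shows "cdim_le_1 sc"
proof -
  have "x \<in> closure (range (\<lambda>z. sc z v))" for x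
    unfolding closure_approachable using assms[of _ x]
    by (metis dist_commute dist_norm rangeI)
  then have "x \<in> range (\<lambda>z. sc z v)" for x
    using closed_line by simp
  then show ?thesis unfolding cdim_le_1_def by blast
qed

lemma spectral_radius_sc_le: "spectral_radius (sc z x) \<le> cmod z * spectral_radius x"
proof (cases "z = 0")
  case True
  then show ?thesis by simp
next
  case False
  show ?thesis
  proof (rule spectral_radius_leI)
    fix c assume "c > cmod z * spectral_radius x"
    then have "spectral_radius x < c / cmod z" using False by (simp add: field_simps)
    then have g: "geom_bounded x (c / cmod z)" by (rule geom_bounded_if_spectral_radius_less)
    then have c: "c > 0" using False by (simp add: geom_bounded_def zero_less_divide_iff)
    obtain C where C: "\<And>n v. norm (((*) x ^^ n) v) \<le> C * (c / cmod z) ^ n * norm v"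
      using geom_boundedE[OF g] by metis
    have "((*) (sc z x) ^^ n) v = sc (z ^ n) (((*) x ^^ n) v)" for n v
      by (induction n) (simp_all add: mult_sc_left mult_sc_right sc_sc)
    then have "norm (((*) (sc z x) ^^ n) v) \<le> C * c ^ n * norm v" for n v
      using mult_left_mono[OF C[of n v], of "cmod z ^ n"] False
      by (simp add: norm_sc norm_power power_divide)
    with c show "geom_bounded (sc z x) c" unfolding geom_bounded_def by blast
  qed
qed

lemma spectral_radius_sc: "spectral_radius (sc z x) = cmod z * spectral_radius x"
proof (cases "z = 0")
  case False
  have "spectral_radius x = spectral_radius (sc (inverse z) (sc z x))"
    using False by (simp add: sc_sc)
  also have "\<dots> \<le> cmod (inverse z) * spectral_radius (sc z x)"
    by (rule spectral_radius_sc_le)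
  finally have "cmod z * spectral_radius x \<le> spectral_radius (sc z x)"
    using False by (simp add: norm_inverse) (simp add: field_simps)
  with spectral_radius_sc_le[of z x] show ?thesis by simp
qed simp

lemma spectral_radius_minus [simp]: "spectral_radius (- x :: 'a) = spectral_radius x"
  using spectral_radius_sc[of "-1" x] by (simp add: sc_minus_left)

lemma spectral_radius_scaleR: "spectral_radius (scaleR t x :: 'a) = \<bar>t\<bar> * spectral_radius x"
  using spectral_radius_sc[of "of_real t" x] by (simp add: sc_of_real)

text \<open>Division with remainder, \<open>N = i + n * k\<close>, reduces powers of
  \<open>x\<close> to powers of \<open>apow x n\<close>; a growth rate \<open>c\<close> of the
  latter gives the rate \<open>root n c\<close> for \<open>x\<close>.\<close>

lemma spectral_radius_power_le:
  assumes "n \<ge> 1"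
  shows "spectral_radius x ^ n \<le> spectral_radius (apow x n)"
proof (rule dense_ge)
  fix c assume "spectral_radius (apow x n) < c"
  then have g: "geom_bounded (apow x n) c" by (rule geom_bounded_if_spectral_radius_less)
  then have c: "c > 0" by (simp add: geom_bounded_def)
  obtain C where C: "C > 0" "\<And>k v. norm (((*) (apow x n) ^^ k) v) \<le> C * c ^ k * norm v"
    using geom_boundedE[OF g] by metis
  define d where "d = root n c"
  have d: "d > 0" "d ^ n = c" using c assms by (auto simp: d_def)
  \<comment> \<open>A common bound for \<open>(norm x / d) ^ i\<close> over all remainders
    \<open>i < n\<close>; adding 1 makes the power increasing in the exponent.\<close>
  define M where "M = (1 + norm x / d) ^ n"
  have "norm (((*) x ^^ N) v) \<le> (M * C) * d ^ N * norm v" for N v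
  proof -
    define k i where "k = N div n" and "i = N mod n"
    have N: "N = i + n * k" by (simp add: k_def i_def)
    have dN: "d ^ N = d ^ i * c ^ k"
      by (simp add: N power_add power_mult d(2))
    have i: "i < n" using assms by (simp add: i_def)
    have "(*) x ^^ n = (*) (apow x n)"
      using assms by (simp add: fun_eq_iff funpow_mult_apow)
    then have "((*) x ^^ (n * k)) v = ((*) (apow x n) ^^ k) v"
      by (simp add: funpow_mult [symmetric])
    then have "((*) x ^^ N) v = ((*) x ^^ i) (((*) (apow x n) ^^ k) v)"
      by (simp add: N funpow_add)
    then have "norm (((*) x ^^ N) v) \<le> norm x ^ i * norm (((*) (apow x n) ^^ k) v)"
      by (simp add: norm_funpow_mult_le)
    also have "\<dots> \<le> norm x ^ i * (C * c ^ k * norm v)"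
      by (intro mult_left_mono C) auto
    also have "norm x ^ i = (norm x / d) ^ i * d ^ i"
      using d by (simp add: power_divide)
    also have "(norm x / d) ^ i * d ^ i * (C * c ^ k * norm v)
        = (norm x / d) ^ i * (C * d ^ N * norm v)"
      using dN by (simp add: mult_ac)
    also have "\<dots> \<le> M * (C * d ^ N * norm v)"
    proof (rule mult_right_mono)
      have "(norm x / d) ^ i \<le> (1 + norm x / d) ^ i"
        using d by (intro power_mono) auto
      also have "\<dots> \<le> M" unfolding M_def
        using d i by (intro power_increasing) auto
      finally show "(norm x / d) ^ i \<le> M" .
      show "0 \<le> C * d ^ N * norm v" using C d by simp
    qed
    finally show ?thesis by (simp add: mult.assoc)
  qed
  then have "geom_bounded x d" using d unfolding geom_bounded_def by blast
  then have "spectral_radius x \<le> d" by (rule spectral_radius_le)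
  then have "spectral_radius x ^ n \<le> d ^ n" by (intro power_mono) auto
  with d show "spectral_radius x ^ n \<le> c" by simp
qed

end

locale comm_complex_banach_alg = complex_banach_alg sc
  for sc :: "complex \<Rightarrow> 'a::{real_normed_algebra,banach} \<Rightarrow> 'a" +
  assumes comm: "(x::'a) * y = y * x"
begin

lemma left_comm: "x * (y * z) = y * (x * (z :: 'a))"
  by (metis comm mult.assoc)

lemma funpow_mult_comm: "((*) x ^^ n) (y * v) = y * ((*) x ^^ n) (v :: 'a)"
  by (induction n) (simp_all add: left_comm)

lemma spectral_radius_mult_le:
  "spectral_radius (x * y :: 'a) \<le> spectral_radius x * spectral_radius y"
proof -
  have *: "spectral_radius (x * y) \<le> c * d"
    if "spectral_radius x < c" "spectral_radius y < d" for c d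
  proof -
    have gx: "geom_bounded x c" and gy: "geom_bounded y d"
      using that geom_bounded_if_spectral_radius_less by blast+
    obtain C where C: "C > 0" "\<And>n v. norm (((*) x ^^ n) v) \<le> C * c ^ n * norm v"
      using geom_boundedE[OF gx] by metis
    obtain D where D: "D > 0" "\<And>n v. norm (((*) y ^^ n) v) \<le> D * d ^ n * norm v"
      using geom_boundedE[OF gy] by metis
    have cd: "c > 0" "d > 0" using gx gy by (auto simp: geom_bounded_def)
    have eq: "((*) (x * y) ^^ n) v = ((*) x ^^ n) (((*) y ^^ n) v)" for n v
    proof (induction n)
      case (Suc n)
      have "((*) (x * y) ^^ Suc n) v = x * (y * ((*) x ^^ n) (((*) y ^^ n) v))"
        by (simp add: Suc mult.assoc)
      then show ?case by (simp add: funpow_mult_comm)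
    qed simp
    have "norm (((*) (x * y) ^^ n) v) \<le> (C * D) * (c * d) ^ n * norm v" for n v
    proof -
      have "norm (((*) (x * y) ^^ n) v) \<le> C * c ^ n * norm (((*) y ^^ n) v)"
        unfolding eq by (rule C)
      also have "\<dots> \<le> C * c ^ n * (D * d ^ n * norm v)"
        using C cd by (intro mult_left_mono D) auto
      finally show ?thesis by (simp add: power_mult_distrib mult_ac)
    qed
    then have "geom_bounded (x * y) (c * d)"
      using cd unfolding geom_bounded_def by auto
    then show ?thesis by (rule spectral_radius_le)
  qed
  \<comment> \<open>The rates are lowered one after the other: first \<open>c\<close>, after
    division by the positive \<open>d\<close>, then \<open>d\<close> by a limit from the right,
    since \<open>spectral_radius y\<close> may be 0.\<close>
  have "spectral_radius (x * y) \<le> spectral_radius x * d" if "spectral_radius y < d" for d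
  proof -
    have d: "d > 0" using that spectral_radius_nonneg[of y] by linarith
    have "spectral_radius (x * y) / d \<le> spectral_radius x"
    proof (rule dense_ge)
      fix c assume "spectral_radius x < c"
      from *[OF this that] d show "spectral_radius (x * y) / d \<le> c"
        by (simp add: field_simps)
    qed
    with d show ?thesis by (simp add: field_simps)
  qed
  then have "\<forall>\<^sub>F d in at_right (spectral_radius y). spectral_radius (x * y) \<le> spectral_radius x * d"
    by (rule eventually_mono[OF eventually_at_right_less])
  moreover have "((\<lambda>d. spectral_radius x * d) \<longlongrightarrow> spectral_radius x * spectral_radius y)
      (at_right (spectral_radius y))"
    by (intro tendsto_intros)
  ultimately show ?thesis
    by (intro tendsto_lowerbound[of _ _ "at_right (spectral_radius y)"]) auto
qed

lemma spectral_radius_add_le: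
  "spectral_radius (x + y :: 'a) \<le> spectral_radius x + spectral_radius y"
proof (rule field_le_epsilon)
  fix \<epsilon> :: real assume \<epsilon>: "\<epsilon> > 0"
  define c d where "c = spectral_radius x + \<epsilon> / 2" and "d = spectral_radius y + \<epsilon> / 2"
  have gx: "geom_bounded x c" and gy: "geom_bounded y d"
    using \<epsilon> by (auto simp: c_def d_def intro!: geom_bounded_if_spectral_radius_less)
  obtain C where C: "C > 0" "\<And>n v. norm (((*) x ^^ n) v) \<le> C * c ^ n * norm v"
    using geom_boundedE[OF gx] by metis
  obtain D where D: "D > 0" "\<And>n v. norm (((*) y ^^ n) v) \<le> D * d ^ n * norm v"
    using geom_boundedE[OF gy] by metis
  have cd: "c > 0" "d > 0" using gx gy by (auto simp: geom_bounded_def)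
  \<comment> \<open>In place of the binomial theorem, factors \<open>x\<close> and \<open>y\<close>
    are carried along: splitting off one \<open>x + y\<close> raises \<open>i\<close> or
    \<open>k\<close> by one, and the two bounds add up to a factor \<open>c + d\<close>.\<close>
  have *: "norm (((*) x ^^ i) (((*) y ^^ k) (((*) (x + y) ^^ n) v)))
      \<le> (C * D) * c ^ i * d ^ k * (c + d) ^ n * norm v" for i k n v
  proof (induction n arbitrary: i k)
    case 0
    have "norm (((*) x ^^ i) (((*) y ^^ k) v)) \<le> C * c ^ i * norm (((*) y ^^ k) v)"
      by (rule C)
    also have "\<dots> \<le> C * c ^ i * (D * d ^ k * norm v)"
      using C cd by (intro mult_left_mono D) auto
    finally show ?case by (simp add: mult_ac)
  next
    case (Suc n)
    define u where "u = ((*) (x + y) ^^ n) v"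
    have "((*) y ^^ k) ((x + y) * u) = (x + y) * ((*) y ^^ k) u"
      by (rule funpow_mult_comm)
    then have "((*) x ^^ i) (((*) y ^^ k) ((x + y) * u)) = (x + y) * ((*) x ^^ i) (((*) y ^^ k) u)"
      by (simp add: funpow_mult_comm)
    also have "\<dots> = ((*) x ^^ Suc i) (((*) y ^^ k) u) + ((*) x ^^ i) (((*) y ^^ Suc k) u)"
      by (simp add: distrib_right funpow_mult_comm)
    finally have "norm (((*) x ^^ i) (((*) y ^^ k) (((*) (x + y) ^^ Suc n) v)))
      \<le> norm (((*) x ^^ Suc i) (((*) y ^^ k) u)) + norm (((*) x ^^ i) (((*) y ^^ Suc k) u))"
      by (simp add: u_def norm_triangle_ineq)
    also have "\<dots> \<le> (C * D) * c ^ Suc i * d ^ k * (c + d) ^ n * norm v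
        + (C * D) * c ^ i * d ^ Suc k * (c + d) ^ n * norm v"
      unfolding u_def by (intro add_mono Suc)
    also have "\<dots> = (C * D) * c ^ i * d ^ k * (c + d) ^ Suc n * norm v"
      by (simp add: algebra_simps)
    finally show ?case .
  qed
  have "norm (((*) (x + y) ^^ n) v) \<le> (C * D) * (c + d) ^ n * norm v" for n v
    using *[of 0 0 n v] by simp
  then have "geom_bounded (x + y) (c + d)"
    using cd unfolding geom_bounded_def by auto
  then have "spectral_radius (x + y) \<le> c + d" by (rule spectral_radius_le)
  then show "spectral_radius (x + y) \<le> spectral_radius x + spectral_radius y + \<epsilon>"
    by (simp add: c_def d_def)
qed

lemma spectral_radius_diff_le:
  "spectral_radius (x - y :: 'a) \<le> spectral_radius x + spectral_radius y"
  using spectral_radius_add_le[of x "- y"] by simp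

lemma spectral_radius_diff_abs:
  "\<bar>spectral_radius x - spectral_radius y\<bar> \<le> spectral_radius (x - y :: 'a)"
proof -
  have "spectral_radius (y - x) = spectral_radius (x - y)"
    using spectral_radius_minus[of "x - y"] by simp
  then show ?thesis
    using spectral_radius_add_le[of "x - y" y] spectral_radius_add_le[of "y - x" x] by simp
qed

lemma continuous_on_spectral_radius: "continuous_on UNIV (spectral_radius :: 'a \<Rightarrow> real)"
proof (rule continuous_on_iff[THEN iffD2], intro ballI allI impI)
  fix x :: 'a and \<epsilon> :: real assume "\<epsilon> > 0"
  have "dist (spectral_radius y) (spectral_radius x) \<le> dist y x" for y :: 'a
    using spectral_radius_diff_abs[of y x] spectral_radius_le_norm[of "y - x"]
    by (simp add: dist_norm)
  with \<open>\<epsilon> > 0\<close> show "\<exists>d>0. \<forall>y\<in>UNIV. dist y x < d \<longrightarrow>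
      dist (spectral_radius y) (spectral_radius x) < \<epsilon>"
    by (meson le_less_trans)
qed

lemma tendsto_spectral_radius:
  "(f \<longlongrightarrow> (x::'a)) F \<Longrightarrow> ((\<lambda>n. spectral_radius (f n)) \<longlongrightarrow> spectral_radius x) F"
  using continuous_on_tendsto_compose[OF continuous_on_spectral_radius] by auto

lemma spectral_radius_apow: "n \<ge> 1 \<Longrightarrow> spectral_radius (apow x n :: 'a) = spectral_radius x ^ n"
proof (rule antisym)
  show "n \<ge> 1 \<Longrightarrow> spectral_radius (apow x n) \<le> spectral_radius x ^ n"
  proof (induction n rule: dec_induct)
    case (step k)
    have "spectral_radius (apow x (Suc k)) \<le> spectral_radius x * spectral_radius (apow x k)"
      using step by (simp add: apow_Suc spectral_radius_mult_le)
    also have "\<dots> \<le> spectral_radius x * spectral_radius x ^ k"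
      by (intro mult_left_mono step) auto
    finally show ?case by simp
  qed simp
qed (rule spectral_radius_power_le)

subsection \<open>Quasinilpotent elements\<close>

text \<open>By the rules below this is a closed ideal, so that identities can be read modulo
  it.\<close>

definition quasinil :: "'a set" where
  "quasinil = {x. spectral_radius x = 0}"

lemma quasinilI: "spectral_radius x \<le> 0 \<Longrightarrow> x \<in> quasinil"
  unfolding quasinil_def mem_Collect_eq by (rule antisym) simp_all

lemma quasinil_0 [simp]: "0 \<in> quasinil"
  by (simp add: quasinil_def)

lemma quasinil_add: "x \<in> quasinil \<Longrightarrow> y \<in> quasinil \<Longrightarrow> x + y \<in> quasinil"
  using spectral_radius_add_le[of x y] by (intro quasinilI) (simp add: quasinil_def)

lemma quasinil_minus: "x \<in> quasinil \<Longrightarrow> - x \<in> quasinil"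
  by (simp add: quasinil_def)

lemma quasinil_diff: "x \<in> quasinil \<Longrightarrow> y \<in> quasinil \<Longrightarrow> x - y \<in> quasinil"
  using quasinil_add[of x "- y"] quasinil_minus[of y] by simp

lemma quasinil_mult_left: "x \<in> quasinil \<Longrightarrow> x * y \<in> quasinil"
  using spectral_radius_mult_le[of x y] by (intro quasinilI) (simp add: quasinil_def)

lemma quasinil_mult_right: "y \<in> quasinil \<Longrightarrow> x * y \<in> quasinil"
  using quasinil_mult_left[of y x] by (simp add: comm)

lemma quasinil_scaleR: "x \<in> quasinil \<Longrightarrow> scaleR t x \<in> quasinil"
  by (simp add: quasinil_def spectral_radius_scaleR)

lemma quasinil_sc: "x \<in> quasinil \<Longrightarrow> sc z x \<in> quasinil"
  by (simp add: quasinil_def spectral_radius_sc)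

lemma quasinil_apow: "x \<in> quasinil \<Longrightarrow> n \<ge> 1 \<Longrightarrow> apow x n \<in> quasinil"
  by (simp add: quasinil_def spectral_radius_apow)

lemma quasinil_sum: "(\<And>i. i \<in> I \<Longrightarrow> f i \<in> quasinil) \<Longrightarrow> sum f I \<in> quasinil"
  by (induction I rule: infinite_finite_induct) (auto intro: quasinil_add)

lemma quasinil_LIMSEQ: "f \<longlonglongrightarrow> x \<Longrightarrow> (\<And>n. f n \<in> quasinil) \<Longrightarrow> x \<in> quasinil"
  using tendsto_spectral_radius[of f x sequentially]
  by (simp add: quasinil_def LIMSEQ_const_iff)

lemmas quasinil_intros = quasinil_add quasinil_diff quasinil_minus quasinil_mult_left
  quasinil_mult_right quasinil_scaleR quasinil_sc

end

section \<open>The binomial series\<close>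

text \<open>Consecutive coefficients differ by the factor (c - m)/(m + 1), of absolute value at most
  1. The binomial series is thus dominated by the powers of its argument.\<close>

lemma abs_gbinomial_le_1:
  fixes c :: real
  assumes "\<bar>c\<bar> \<le> 1"
  shows "\<bar>c gchoose m\<bar> \<le> 1"
proof (induction m)
  case (Suc m)
  have "(c gchoose Suc m) = (c gchoose m) * ((c - real m) / (real m + 1))"
    using gbinomial_mult_1[of c m] by (simp add: field_simps)
  moreover have "\<bar>(c - real m) / (real m + 1)\<bar> \<le> 1"
    using assms by (auto simp: abs_le_iff field_simps)
  ultimately show ?case using Suc by (simp only: abs_mult mult_le_one abs_ge_zero)
qed simp

context comm_complex_banach_alg
begin

text \<open>The element \<open>(1 + y)\<^sup>c - 1\<close> of the formal unitization, which lies in the algebra itself.\<close>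

definition binom_term :: "real \<Rightarrow> 'a \<Rightarrow> nat \<Rightarrow> 'a" where
  "binom_term c y m = (if m = 0 then 0 else (c gchoose m) *\<^sub>R apow y m)"

definition binom_series :: "real \<Rightarrow> 'a \<Rightarrow> 'a" where
  "binom_series c y = (\<Sum>m. binom_term c y m)"

lemma norm_binom_term_le:
  assumes "\<bar>c\<bar> \<le> 1" "m \<ge> 1"
  shows "norm (binom_term c y m) \<le> norm (apow y m)"
  using mult_right_mono[OF abs_gbinomial_le_1[OF assms(1), of m] norm_ge_zero[of "apow y m"]] assms(2)
  by (simp add: binom_term_def)

lemma summable_norm_binom_term:
  assumes "\<bar>c\<bar> \<le> 1" "spectral_radius y < 1"
  shows "summable (\<lambda>m. norm (binom_term c y m))"
proof -
  obtain d where d: "spectral_radius y < d" "d < 1" using dense[OF assms(2)] by blast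
  then have d0: "d > 0" using spectral_radius_nonneg[of y] by linarith
  obtain C where C: "C > 0" "\<And>n. n \<ge> 1 \<Longrightarrow> norm (apow y n) \<le> C * d ^ n"
    using apow_geom_bound[OF d(1)] by metis
  show ?thesis
  proof (rule summable_comparison_test)
    show "summable (\<lambda>n. C * d ^ n)" using d d0 by (intro summable_mult summable_geometric) auto
    show "\<exists>N. \<forall>n\<ge>N. norm (norm (binom_term c y n)) \<le> C * d ^ n"
      using C(2) by (intro exI[of _ 1]) (auto intro!: order_trans[OF norm_binom_term_le[OF assms(1)]])
  qed
qed

lemma summable_binom_term:
  "\<bar>c\<bar> \<le> 1 \<Longrightarrow> spectral_radius y < 1 \<Longrightarrow> summable (binom_term c y)"
  by (rule summable_norm_cancel[OF summable_norm_binom_term])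

text \<open>Vandermonde's identity and the Cauchy product give (1 + y)^c (1 + y)^d = (1 + y)^(c + d)
  in the unitization; removing the ones leaves this form.\<close>

lemma binom_series_mult:
  assumes "\<bar>c\<bar> \<le> 1" "\<bar>d\<bar> \<le> 1" "\<bar>c + d\<bar> \<le> 1" "spectral_radius y < 1"
  shows "binom_series c y * binom_series d y
    = binom_series (c + d) y - binom_series c y - binom_series d y"
proof -
  \<comment> \<open>The summands \<open>i = 0\<close> and \<open>i = k\<close> vanish here, whereas
    Vandermonde's sum contains them as \<open>d gchoose k\<close> and \<open>c gchoose k\<close>;
    they are the two subtracted terms.\<close>
  have conv: "(\<Sum>i\<le>k. binom_term c y i * binom_term d y (k - i))
      = binom_term (c + d) y k - binom_term c y k - binom_term d y k" for k
  proof (cases "k = 0")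
    case True
    then show ?thesis by (simp add: binom_term_def)
  next
    case False
    have split: "{..k} = {0, k} \<union> {1..<k}" using False by auto
    have "(\<Sum>i\<le>k. binom_term c y i * binom_term d y (k - i))
        = (\<Sum>i\<in>{1..<k}. binom_term c y i * binom_term d y (k - i))"
      using False by (subst split, subst sum.union_disjoint) (auto simp: binom_term_def)
    also have "\<dots> = (\<Sum>i\<in>{1..<k}. ((c gchoose i) * (d gchoose (k - i))) *\<^sub>R apow y k)"
      by (intro sum.cong refl) (auto simp: binom_term_def apow_add)
    also have "\<dots> = (\<Sum>i\<in>{1..<k}. (c gchoose i) * (d gchoose (k - i))) *\<^sub>R apow y k"
      by (simp add: scaleR_left.sum)
    also have "(\<Sum>i\<in>{1..<k}. (c gchoose i) * (d gchoose (k - i)))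
        = (\<Sum>i\<le>k. (c gchoose i) * (d gchoose (k - i))) - (c gchoose k) - (d gchoose k)"
      using False by (subst split, subst sum.union_disjoint) auto
    also have "(\<Sum>i\<le>k. (c gchoose i) * (d gchoose (k - i))) = (c + d) gchoose k"
      using gbinomial_Vandermonde[of c d k] by (simp add: atLeast0AtMost)
    finally show ?thesis using False by (simp add: binom_term_def algebra_simps)
  qed
  have "binom_series c y * binom_series d y
      = (\<Sum>k. \<Sum>i\<le>k. binom_term c y i * binom_term d y (k - i))"
    unfolding binom_series_def using assms
    by (intro Cauchy_product summable_norm_binom_term)
  also have "\<dots> = (\<Sum>k. binom_term (c + d) y k - binom_term c y k - binom_term d y k)"
    by (simp only: conv)
  also have "\<dots> = binom_series (c + d) y - binom_series c y - binom_series d y"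
    unfolding binom_series_def using assms
    by (simp add: summable_binom_term summable_diff suminf_diff)
  finally show ?thesis .
qed

lemma binom_series_0 [simp]: "binom_series 0 y = 0"
proof -
  have "binom_term 0 y = (\<lambda>m. 0)" by (auto simp: binom_term_def gbinomial_0_left)
  then show ?thesis by (simp add: binom_series_def)
qed

lemma binom_series_1 [simp]: "binom_series 1 y = y"
proof -
  have *: "binom_term 1 y m = (if m = 1 then y else 0)" for m
  proof (cases "m = 0")
    case False
    then have "((1::real) gchoose m) = (if m = 1 then 1 else 0)"
      using binomial_gbinomial[of 1 m, where ?'a = real] by (auto simp: binomial_eq_0)
    with False show ?thesis by (auto simp: binom_term_def)
  qed (simp add: binom_term_def)
  show ?thesis
    unfolding binom_series_def * using sums_single[of 1 "\<lambda>_. y"] by (simp add: sums_iff)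
qed

lemma binom_series_quasinil:
  assumes "\<bar>c\<bar> \<le> 1" "y \<in> quasinil"
  shows "binom_series c y \<in> quasinil"
proof (rule quasinil_LIMSEQ)
  show "(\<lambda>n. \<Sum>m<n. binom_term c y m) \<longlonglongrightarrow> binom_series c y"
    unfolding binom_series_def
    using assms by (intro summable_LIMSEQ summable_binom_term) (auto simp: quasinil_def)
  show "(\<Sum>m<n. binom_term c y m) \<in> quasinil" for n
    using assms by (intro quasinil_sum) (auto simp: binom_term_def quasinil_apow quasinil_scaleR)
qed

lemma norm_apow_le: "n \<ge> 1 \<Longrightarrow> norm (apow y n :: 'a) \<le> norm y ^ n"
proof (induction n rule: dec_induct)
  case (step k)
  then show ?case
    using norm_mult_ineq[of y "apow y k"] mult_left_mono[OF step.IH norm_ge_zero[of y]]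
    by (simp add: apow_Suc)
qed simp

text \<open>Comparison with a geometric series. The bound is uniform in \<open>c\<close>, so that
  n-th roots are controlled without control of n.\<close>

lemma norm_binom_series_le:
  assumes "\<bar>c\<bar> \<le> 1" "norm y \<le> 1/2"
  shows "norm (binom_series c y) \<le> 2 * norm y"
proof -
  have s: "(\<lambda>n. norm y * norm y ^ n) sums (norm y * (1 / (1 - norm y)))"
    using assms by (intro sums_mult geometric_sums) auto
  have r: "spectral_radius y < 1" using assms(2) spectral_radius_le_norm[of y] by simp
  have "binom_series c y = (\<Sum>m. binom_term c y (Suc m))"
    unfolding binom_series_def
    using suminf_split_head[OF summable_binom_term[OF assms(1) r]] by (simp add: binom_term_def)
  also have "norm \<dots> \<le> (\<Sum>m. norm y * norm y ^ m)"
  proof (rule norm_suminf_le)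
    show "norm (binom_term c y (Suc m)) \<le> norm y * norm y ^ m" for m
      using norm_binom_term_le[OF assms(1), of "Suc m" y] norm_apow_le[of "Suc m" y] by simp
  qed (use s sums_summable in blast)
  also have "\<dots> = norm y * (1 / (1 - norm y))" using s by (simp add: sums_iff)
  also have "\<dots> \<le> norm y * 2"
    using assms(2) by (intro mult_left_mono) (auto simp: field_simps)
  finally show ?thesis by simp
qed

section \<open>Roots of order n in the formal unitization\<close>

text \<open>The element (1 + x)^n - 1 of the unitization.\<close>

fun circ_pow :: "nat \<Rightarrow> 'a \<Rightarrow> 'a" where
  "circ_pow 0 x = 0"
| "circ_pow (Suc n) x = circ_pow n x + x + circ_pow n x * x"

lemma circ_pow_binom_series:
  assumes "n \<ge> 1" "spectral_radius y < 1"
  shows "circ_pow n (binom_series (1 / real n) y) = y"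
proof -
  \<comment> \<open>Each step adds 1/n to the exponent; \<open>k \<le> n\<close> keeps the exponents
    in the range of \<open>binom_series_mult\<close>.\<close>
  have "k \<le> n \<Longrightarrow> circ_pow k (binom_series (1 / real n) y) = binom_series (real k / real n) y" for k
  proof (induction k)
    case (Suc k)
    have "binom_series (real k / real n) y * binom_series (1 / real n) y
        = binom_series (real k / real n + 1 / real n) y - binom_series (real k / real n) y
          - binom_series (1 / real n) y"
      using assms Suc.prems by (intro binom_series_mult) (auto simp: field_simps)
    moreover have "real k / real n + 1 / real n = real (Suc k) / real n"
      by (simp add: add_divide_distrib)
    ultimately show ?case using Suc by simp
  qed simp
  from this[of n] show ?thesis using assms by simp
qed

lemma circ_pow_quasinil: "x \<in> quasinil \<Longrightarrow> circ_pow n x \<in> quasinil"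
  by (induction n) (auto intro: quasinil_intros)

text \<open>(1 + p)^n - (1 + q)^n is divisible by p - q, with cofactor n plus a polynomial in p and
  q without constant term, which is quasinilpotent.\<close>

lemma circ_pow_diff:
  assumes "p \<in> quasinil" "q \<in> quasinil"
  shows "\<exists>j\<in>quasinil. circ_pow n p - circ_pow n q = real n *\<^sub>R (p - q) + (p - q) * j"
proof (induction n)
  case 0
  show ?case by (intro bexI[of _ 0]) auto
next
  case (Suc n)
  then obtain j where j: "j \<in> quasinil"
    and eq: "circ_pow n p = circ_pow n q + (real n *\<^sub>R (p - q) + (p - q) * j)"
    by (metis add.commute diff_add_cancel)
  show ?case
  \<comment> \<open>Writing P and Q for the two circle powers, P p - Q q = Q (p - q) + (P - Q) p,
    and the induction hypothesis replaces P - Q.\<close>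
  proof (intro bexI[of _ "j + (circ_pow n q + real n *\<^sub>R p + j * p)"])
    show "j + (circ_pow n q + real n *\<^sub>R p + j * p) \<in> quasinil"
      using assms j by (intro quasinil_intros circ_pow_quasinil)
    show "circ_pow (Suc n) p - circ_pow (Suc n) q
        = real (Suc n) *\<^sub>R (p - q) + (p - q) * (j + (circ_pow n q + real n *\<^sub>R p + j * p))"
      by (simp add: eq algebra_simps comm left_comm)
  qed
qed

text \<open>Dividing \<open>circ_pow_diff\<close> by n shows that \<open>p - q\<close> is reproduced
  by a quasinilpotent factor, hence zero: n-th roots of the form 1 + quasinilpotent are
  unique.\<close>

lemma circ_pow_inj:
  assumes "p \<in> quasinil" "q \<in> quasinil" "n \<ge> 1" "circ_pow n p = circ_pow n q"
  shows "p = q"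
proof -
  obtain j where j: "j \<in> quasinil" "real n *\<^sub>R (p - q) + (p - q) * j = 0"
    using circ_pow_diff[OF assms(1,2), of n] assms(4) by auto
  define w where "w = p - q"
  have "real n *\<^sub>R w = - (w * j)"
    using j(2) by (simp add: w_def eq_neg_iff_add_eq_0)
  then have "(1 / real n) *\<^sub>R (real n *\<^sub>R w) = w * (- (1 / real n) *\<^sub>R j)"
    by simp
  then have "w = w * (- (1 / real n) *\<^sub>R j)"
    using assms(3) by simp
  moreover have "spectral_radius (- (1 / real n) *\<^sub>R j) = 0"
    using quasinil_scaleR[OF j(1)] by (simp only: quasinil_def mem_Collect_eq)
  ultimately have "w = 0" using eq_0_if_quasinilpotent_eigen comm by blast
  then show ?thesis by (simp add: w_def)
qed

end

section \<open>Supercyclic elements\<close>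

locale supercyclic_element = complex_banach_alg sc
  for sc :: "complex \<Rightarrow> 'a::{real_normed_algebra,banach} \<Rightarrow> 'a" +
  fixes a :: 'a
  assumes dense: "closure {sc z (apow a n) |z n. n \<ge> 1} = UNIV"
begin

lemma approx:
  assumes "\<epsilon> > 0"
  obtains z n where "n \<ge> 1" "norm (x - sc z (apow a n)) < \<epsilon>"
proof -
  have "x \<in> closure {sc z (apow a n) |z n. n \<ge> 1}" by (simp only: dense UNIV_I)
  then show ?thesis
    using assms that unfolding closure_approachable
    by (auto simp: dist_norm norm_minus_commute)
qed

lemma closed_predicate_holds:
  assumes "closed {x. P x}" "\<And>z n. n \<ge> 1 \<Longrightarrow> P (sc z (apow a n))"
  shows "P x"
proof -
  have "closure {sc z (apow a n) |z n. n \<ge> 1} \<subseteq> {x. P x}"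
    using assms by (intro closure_minimal) auto
  then show ?thesis using dense by auto
qed

text \<open>Multiples of powers of \<open>a\<close> commute with each other; density frees first one
  factor, then the other.\<close>

lemma algebra_commutes: "x * y = y * (x::'a)"
proof -
  have "x * sc w (apow a m) = sc w (apow a m) * x" if m: "m \<ge> 1" for x w m
  proof (rule closed_predicate_holds[of "\<lambda>x. x * sc w (apow a m) = sc w (apow a m) * x"])
    show "closed {x. x * sc w (apow a m) = sc w (apow a m) * x}"
      by (intro closed_Collect_eq continuous_intros)
  qed (use m in \<open>simp add: mult_sc_left mult_sc_right sc_sc apow_add mult.commute add.commute\<close>)
  then have "sc w (apow a m) * x = x * sc w (apow a m)" if "m \<ge> 1" for x w m
    using that by simp
  moreover have "closed {x. x * y = y * x}"
    by (intro closed_Collect_eq continuous_intros)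
  ultimately show ?thesis
    by (rule closed_predicate_holds[of "\<lambda>x. x * y = y * x", rotated])
qed

end

sublocale supercyclic_element \<subseteq> comm_complex_banach_alg
  by unfold_locales (rule algebra_commutes)

context supercyclic_element
begin

text \<open>The factor \<open>w ^ n\<close> is absorbed into the scalar. This allows
  \<open>a\<close> to be normalized.\<close>

lemma supercyclic_element_sc:
  assumes "w \<noteq> 0"
  shows "supercyclic_element sc (sc w a)"
proof unfold_locales
  have "{sc z (apow a n) |z n. n \<ge> 1} \<subseteq> {sc z (apow (sc w a) n) |z n. n \<ge> 1}"
  proof clarify
    fix z and n :: nat assume n: "n \<ge> 1"
    then have "sc z (apow a n) = sc (z / w ^ n) (apow (sc w a) n)"
      using assms by (simp add: apow_sc sc_sc)
    with n show "\<exists>z' n'. sc z (apow a n) = sc z' (apow (sc w a) n') \<and> 1 \<le> n'" by blast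
  qed
  from closure_mono[OF this] show "closure {sc z (apow (sc w a) n) |z n. n \<ge> 1} = UNIV"
    using dense by auto
qed

section \<open>Multiplicativity of the spectral radius and the Gelfand-Mazur argument\<close>

text \<open>On multiples of powers of \<open>a\<close> equality holds because the radius of
  \<open>apow a n\<close> is the n-th power of that of \<open>a\<close>; continuity and density
  extend it to one factor at a time.\<close>

lemma spectral_radius_mult: "spectral_radius (x * y) = spectral_radius x * spectral_radius (y::'a)"
proof -
  have cont: "continuous_on UNIV (\<lambda>x. spectral_radius (f x))" if "continuous_on UNIV f" for f :: "'a \<Rightarrow> 'a"
    using that continuous_on_compose2[OF continuous_on_spectral_radius that] by auto
  have 1: "spectral_radius (x * sc w (apow a m)) = spectral_radius x * spectral_radius (sc w (apow a m))"
    if m: "m \<ge> 1" for x w m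
  proof (rule closed_predicate_holds[of "\<lambda>x. spectral_radius (x * sc w (apow a m))
        = spectral_radius x * spectral_radius (sc w (apow a m))"])
    show "closed {x. spectral_radius (x * sc w (apow a m))
        = spectral_radius x * spectral_radius (sc w (apow a m))}"
      by (intro closed_Collect_eq continuous_intros cont)
  qed (use m in \<open>simp add: mult_sc_left mult_sc_right sc_sc apow_add spectral_radius_sc
        spectral_radius_apow norm_mult power_add\<close>)
  show ?thesis
  proof (rule closed_predicate_holds[of "\<lambda>y. spectral_radius (x * y) = spectral_radius x * spectral_radius y"])
    show "closed {y. spectral_radius (x * y) = spectral_radius x * spectral_radius y}"
      by (intro closed_Collect_eq continuous_intros cont)
  qed (rule 1)
qed

text \<open>Ostrowski's argument for the theorem of Gelfand and Mazur: as the spectral radius is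
  multiplicative, \<open>m = r(a - z)\<close> minimal and \<open>|w| < m\<close> give
  \<open>r(a - z - w) m\<^sup>N\<^sup>-\<^sup>1 \<le> r((a - z)\<^sup>N - w\<^sup>N) \<le> m\<^sup>N + |w|\<^sup>N\<close> for \<open>N = 2\<^sup>k\<close>, so that the minimum
  is also attained at \<open>z + w\<close>. Everything is multiplied by \<open>a\<close> since there may be no unit.\<close>

lemma spectral_radius_shift_min:
  assumes r1: "spectral_radius a = 1"
    and min: "\<And>v. m \<le> spectral_radius (a * a - sc v a)"
    and eq: "spectral_radius (a * a - sc z a) = m"
    and w: "cmod w < m"
  shows "spectral_radius (a * a - sc (z + w) a) = m"
proof -
  have m: "m > 0" using w norm_ge_zero[of w] by linarith
  \<comment> \<open>Repeated squaring in the unitization: \<open>X k = (x, c)\<close> stands for x +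
    c = (a - z)^(2^k), and \<open>G k v\<close> is the radius of (x + c - v) a.\<close>
  define X where "X = rec_nat (a, - z) (\<lambda>_ (x, c). (x * x + sc (2 * c) x, c * c))"
  define G where "G k v = spectral_radius (fst (X k) * a + sc (snd (X k) - v) a)" for k v
  have X0: "X 0 = (a, - z)" and XS: "X (Suc k) = (fst (X k) * fst (X k) + sc (2 * snd (X k)) (fst (X k)), snd (X k) * snd (X k))" for k
    by (simp_all add: X_def case_prod_beta)
  have G0: "G 0 v = spectral_radius (a * a - sc (z + v) a)" for v
  proof -
    have "a * a + sc (- z - v) a = a * a - sc (z + v) a"
      by (simp add: sc_diff_left sc_add_left sc_minus_left)
    then show ?thesis by (simp add: G_def X0)
  qed
  \<comment> \<open>A difference of squares. Both factors on the right carry an \<open>a\<close>,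
    the left side only one; \<open>r1\<close> removes the surplus.\<close>
  have GS: "G (Suc k) (v * v) = G k v * G k (- v)" for k v
  proof -
    obtain x c where xc: "X k = (x, c)" by (cases "X k")
    have double: "sc (2 * c) y = sc c y + sc c y" "sc (c * 2) y = sc c y + sc c y" for y
      using sc_add_left[of c c y] by (simp_all add: mult.commute)
    have "(x * a + sc (c - v) a) * (x * a + sc (c - (- v)) a)
        = a * ((x * x + sc (2 * c) x) * a + sc (c * c - v * v) a)"
      by (simp add: sc_diff_left sc_add_left distrib_left distrib_right right_diff_distrib
          left_diff_distrib mult_sc_left mult_sc_right sc_sc sc_diff_right sc_add_right
          comm left_comm double algebra_simps)
    then have "G k v * G k (- v) = spectral_radius a * G (Suc k) (v * v)"
      by (simp add: G_def xc XS flip: spectral_radius_mult)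
    then show ?thesis by (simp add: r1)
  qed
  \<comment> \<open>Every \<open>v\<close> has a complex square root, so the bound passes through
    \<open>GS\<close> from k to k + 1.\<close>
  have lower: "m ^ 2 ^ k \<le> G k v" for k v
  proof (induction k arbitrary: v)
    case 0
    show ?case using min by (simp add: G0)
  next
    case (Suc k)
    obtain u where u: "v = u * u" by (metis power2_csqrt power2_eq_square)
    have "m ^ 2 ^ k * m ^ 2 ^ k \<le> G k u * G k (- u)"
      using m by (intro mult_mono Suc order_trans[OF _ Suc]) auto
    then show ?case by (simp add: u GS mult_2 power_add)
  qed
  have G_0: "G k 0 = m ^ 2 ^ k" for k
  proof (induction k)
    case 0
    show ?case using eq by (simp add: G0)
  next
    case (Suc k)
    then show ?case using GS[of k 0] by (simp add: mult_2 power_add)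
  qed
  have upper: "G k v \<le> m ^ 2 ^ k + cmod v" for k v
  proof -
    have "fst (X k) * a + sc (snd (X k) - v) a = (fst (X k) * a + sc (snd (X k) - 0) a) - sc v a"
      by (simp add: sc_diff_left)
    then have "G k v \<le> G k 0 + spectral_radius (sc v a)"
      unfolding G_def using spectral_radius_diff_le by metis
    then show ?thesis by (simp add: G_0 spectral_radius_sc r1)
  qed
  \<comment> \<open>The conjugate factors \<open>G k (- (w ^ 2 ^ k))\<close>, each at least
    \<open>m ^ 2 ^ k\<close>, complete \<open>G 0 w\<close> to the full difference of powers. Their
    exponents sum to 2^k - 1, hence the extra \<open>m\<close> on the right.\<close>
  have chain: "G 0 w * m ^ 2 ^ k \<le> m * G k (w ^ 2 ^ k)" for k
  proof (induction k)
    case (Suc k)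
    have "G 0 w * m ^ 2 ^ Suc k = (G 0 w * m ^ 2 ^ k) * m ^ 2 ^ k"
      by (simp add: mult_2 power_add)
    also have "\<dots> \<le> (m * G k (w ^ 2 ^ k)) * G k (- (w ^ 2 ^ k))"
      using m by (intro mult_mono Suc lower) (auto simp: G_def)
    also have "\<dots> = m * G (Suc k) (w ^ 2 ^ Suc k)"
      by (simp add: mult_2 power_add GS)
    finally show ?case .
  qed simp
  have bound: "G 0 w \<le> m * (1 + (cmod w / m) ^ k)" for k
  proof -
    have "G 0 w * m ^ 2 ^ k \<le> m * (m ^ 2 ^ k + cmod w ^ 2 ^ k)"
      using m upper[of k "w ^ 2 ^ k"]
      by (intro order_trans[OF chain[of k]] mult_left_mono) (auto simp: norm_power)
    also have "\<dots> = m * (1 + (cmod w / m) ^ 2 ^ k) * m ^ 2 ^ k"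
      using m by (simp add: power_divide field_simps)
    finally have "G 0 w \<le> m * (1 + (cmod w / m) ^ 2 ^ k)"
      using m by simp
    also have "\<dots> \<le> m * (1 + (cmod w / m) ^ k)"
      using m w by (intro mult_left_mono add_left_mono power_decreasing) auto
    finally show ?thesis .
  qed
  have "(\<lambda>k. m * (1 + (cmod w / m) ^ k)) \<longlonglongrightarrow> m * (1 + 0)"
    using m w by (intro tendsto_intros LIMSEQ_realpow_zero) auto
  then have "G 0 w \<le> m * (1 + 0)"
    by (rule LIMSEQ_le_const) (use bound in auto)
  with min[of "z + w"] show ?thesis by (simp add: G0)
qed

text \<open>A positive minimum m of the radius over \<open>z\<close> would be attained at all points
  z0 + k m/2 by the shift lemma, although the radius is at least \<open>cmod z - 1\<close>.\<close>

lemma exists_spectral_value: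
  assumes r1: "spectral_radius a = 1"
  obtains z where "a * a - sc z a \<in> quasinil"
proof -
  define h where "h z = spectral_radius (a * a - sc z a)" for z
  have "continuous_on UNIV (\<lambda>z. a * a - sc z a)"
    by (intro continuous_intros bounded_linear.continuous_on[OF bounded_linear_sc_left])
  then have cont: "continuous_on UNIV h"
    unfolding h_def using continuous_on_compose2[OF continuous_on_spectral_radius] by blast
  have grow: "h z \<ge> cmod z - 1" for z
    using spectral_radius_diff_le[of "a * a" "a * a - sc z a"]
    by (simp add: h_def spectral_radius_sc spectral_radius_mult r1)
  \<comment> \<open>Outside the disc of radius 2 the function exceeds 1 = \<open>h 0\<close>, so the
    minimum over the disc is global.\<close>
  have "\<exists>z0\<in>cball 0 2. \<forall>z\<in>cball 0 2. h z0 \<le> h z"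
    by (rule continuous_attains_inf) (auto intro: continuous_on_subset[OF cont])
  then obtain z0 where z0: "\<And>z. cmod z \<le> 2 \<Longrightarrow> h z0 \<le> h z"
    by (meson mem_cball_0)
  have min: "h z0 \<le> h z" for z
  proof (cases "cmod z \<le> 2")
    case False
    have "h z0 \<le> h 0" using z0[of 0] by simp
    also have "h 0 = 1" by (simp add: h_def spectral_radius_mult r1)
    finally show ?thesis using grow[of z] False by linarith
  qed (rule z0)
  show ?thesis
  proof (cases "h z0 = 0")
    case True
    then show ?thesis using that[of z0] by (simp add: h_def quasinil_def)
  next
    case False
    define m where "m = h z0"
    have m: "m > 0" using False by (simp add: m_def h_def order.not_eq_order_implies_strict)
    have "h (z0 + of_real (real k * (m / 2))) = m" for k
    proof (induction k)
      case (Suc k)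
      have "h (z0 + of_real (real k * (m / 2)) + of_real (m / 2)) = m"
        unfolding h_def
      proof (rule spectral_radius_shift_min[OF r1])
        show "m \<le> spectral_radius (a * a - sc v a)" for v
          using min[of v] by (simp only: m_def h_def)
        show "spectral_radius (a * a - sc (z0 + of_real (real k * (m / 2))) a) = m"
          using Suc by (simp only: h_def)
        show "cmod (of_real (m / 2)) < m"
          using m by simp
      qed
      moreover have "z0 + of_real (real k * (m / 2)) + of_real (m / 2)
          = z0 + complex_of_real (real (Suc k) * (m / 2))"
        by (simp only: of_nat_Suc distrib_right mult_1_left of_real_add) simp
      ultimately show ?case by (simp only:)
    qed (simp add: m_def)
    note const = this
    \<comment> \<open>So many steps carry z0 to a point where \<open>grow\<close> forces a value
      above m.\<close>
    obtain k :: nat where k: "real k * (m / 2) > m + 1 + cmod z0"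
      using m reals_Archimedean3[of "m / 2"] by (meson half_gt_zero)
    define t where "t = complex_of_real (real k * (m / 2))"
    have "cmod t = real k * (m / 2)" using m by (simp only: t_def norm_of_real) simp
    then show ?thesis
      using k const[of k, folded t_def] grow[of "z0 + t"] norm_triangle_ineq4[of "z0 + t" z0]
      by simp
  qed
qed

end

section \<open>Idempotents modulo the quasinilpotent elements\<close>

context comm_complex_banach_alg
begin

text \<open>With \<open>j = a\<^sup>2 - a\<close>, the square of \<open>2a - 1\<close> is \<open>1 + 4j\<close>, so
  \<open>(1 + (2a - 1) (1 + 4j)\<^sup>-\<^sup>1\<^sup>/\<^sup>2) / 2\<close> is idempotent.\<close>

lemma exists_idempotent:
  assumes "a * a - a \<in> quasinil"
  obtains e where "e * e = e" "e - a \<in> quasinil"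
proof -
  define j where "j = a * a - a"
  define y where "y = 4 *\<^sub>R j"
  have y: "y \<in> quasinil" using assms by (simp add: y_def j_def quasinil_scaleR)
  then have ry: "spectral_radius y < 1" by (simp add: quasinil_def)
  \<comment> \<open>\<open>f\<close> and \<open>g\<close> are (1 + 4j)^(-1/2) - 1 and (1 + 4j)^(-1)
    - 1; in (1 + (2a - 1)(1 + f))/2 the ones cancel, which leaves \<open>e\<close>.\<close>
  define f g where "f = binom_series (-1/2) y" and "g = binom_series (-1) y"
  define e where "e = a + a * f - (1/2) *\<^sub>R f"
  have fq: "f \<in> quasinil" unfolding f_def by (rule binom_series_quasinil) (use y in auto)
  have ff: "f * f = g - 2 *\<^sub>R f"
    using binom_series_mult[of "-1/2" "-1/2" y] ry by (simp add: f_def g_def scaleR_2)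
  have gy: "g * y = - g - y"
    using binom_series_mult[of "-1" 1 y] ry by (simp add: g_def)
  have "j * g = (1/4) *\<^sub>R (g * y)" by (simp add: y_def comm[of j g])
  then have jg: "j * g = - ((1/4) *\<^sub>R g) - j"
    by (simp add: gy scaleR_right_diff_distrib) (simp add: y_def)
  have half: "(1/2) *\<^sub>R x + (1/2) *\<^sub>R x = x"
    and half': "(1/2) *\<^sub>R x + ((1/2) *\<^sub>R x + v) = x + v" for x v :: 'a
    by (simp_all flip: add.assoc scaleR_left_distrib)
  have aa: "a * a = j + a" by (simp add: j_def)
  have aaz: "a * (a * x) = j * x + a * x" for x
    by (simp add: j_def mult.assoc[symmetric] left_diff_distrib)
  have "e * e = a * a + (a * (a * (f * f)) - a * (f * f)) + (1/4) *\<^sub>R (f * f) + 2 *\<^sub>R (a * (a * f)) - a * f"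
    by (simp add: e_def algebra_simps comm left_comm scaleR_2 half half')
  also have "\<dots> = j + a + j * (f * f) + (1/4) *\<^sub>R (f * f) + 2 *\<^sub>R (j * f + a * f) - a * f"
    by (simp add: aa aaz)
  also have "\<dots> = j + a + (j * g - 2 *\<^sub>R (j * f)) + ((1/4) *\<^sub>R g - (1/2) *\<^sub>R f) + 2 *\<^sub>R (j * f + a * f) - a * f"
    by (simp add: ff right_diff_distrib scaleR_right_diff_distrib)
  also have "\<dots> = e"
    by (simp add: jg e_def scaleR_2)
  finally have "e * e = e" .
  moreover have "e - a \<in> quasinil"
    using fq by (auto simp: e_def add_diff_eq[symmetric] intro!: quasinil_intros)
  ultimately show ?thesis by (rule that)
qed

end

section \<open>Reduction of the non-quasinilpotent case to dimension at most one\<close>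

context supercyclic_element
begin

lemma cdim_le_1_if_quasi_idempotent:
  assumes r1: "spectral_radius a = 1" and j: "a * a - a \<in> quasinil"
  shows "cdim_le_1 sc"
proof -
  obtain e where e: "e * e = e" "e - a \<in> quasinil"
    using exists_idempotent[OF j] by metis
  have re: "spectral_radius e = 1"
    using spectral_radius_diff_abs[of e a] e(2) r1 by (simp add: quasinil_def)
  have pow: "apow a n - e \<in> quasinil" if "n \<ge> 1" for n
    using that
  proof (induction n rule: dec_induct)
    case base
    show ?case using quasinil_minus[OF e(2)] by simp
  next
    case (step k)
    have "apow a (Suc k) - e = a * (apow a k - e) + a * (e - a) + (a * a - a) - (e - a)"
      using step by (simp add: apow_Suc algebra_simps)
    also have "\<dots> \<in> quasinil"
      by (intro quasinil_add quasinil_diff quasinil_mult_right step e j)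
    finally show ?case .
  qed
  \<comment> \<open>Modulo \<open>quasinil\<close> both \<open>x\<close> and \<open>apow a n\<close>
    equal \<open>e\<close>, so the error has the radius of \<open>sc (1 - z) e\<close>, which is
    \<open>cmod (1 - z)\<close>.\<close>
  have scalar: "cmod (1 - z) \<le> norm (x - sc z (apow a n))"
    if "x - e \<in> quasinil" "n \<ge> 1" for x z n
  proof -
    define d where "d = x - sc z (apow a n)"
    have "sc (1 - z) e - d = sc z (apow a n - e) - (x - e)"
      by (simp add: d_def sc_diff_left sc_diff_right)
    also have "\<dots> \<in> quasinil"
      by (intro quasinil_diff[OF quasinil_sc[OF pow]] that)
    finally have "spectral_radius (sc (1 - z) e) = spectral_radius d"
      using spectral_radius_diff_abs[of "sc (1 - z) e" d] by (simp add: quasinil_def)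
    then show ?thesis
      using spectral_radius_le_norm[of d] by (simp add: spectral_radius_sc re d_def)
  qed

  \<comment> \<open>The powers of \<open>s\<close> are dense in \<open>(1 - e)A\<close> but bounded, so \<open>(1 - e)A = 0\<close>.\<close>
  define s where "s = a - e * a"
  have "s = - (a * a - a) - (e - a) * a" by (simp add: s_def algebra_simps)
  then have sq: "s \<in> quasinil"
    using j e(2) by (metis quasinil_diff quasinil_minus quasinil_mult_left)
  then have "spectral_radius s < 1" by (simp add: quasinil_def)
  then obtain M where M: "M > 0" "\<And>n. n \<ge> 1 \<Longrightarrow> norm (apow s n) \<le> M * 1 ^ n"
    using apow_geom_bound by metis
  have es: "e * s = 0" by (simp add: s_def right_diff_distrib e(1) flip: mult.assoc)
  have spow: "apow s n = apow a n - e * apow a n" if "n \<ge> 1" for n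
    using that
  proof (induction n rule: dec_induct)
    case base
    show ?case by (simp add: s_def)
  next
    case (step k)
    have "e * (e * x) = e * x" for x by (simp add: e(1) flip: mult.assoc)
    moreover have "apow s (Suc k) = s * (apow a k - e * apow a k)"
      using step by (simp add: apow_Suc)
    ultimately show ?case
      using step(1) by (simp add: apow_Suc s_def algebra_simps left_comm[of a e])
  qed
  have "s = 0"
  proof (rule ccontr)
    assume "s \<noteq> 0"
    \<comment> \<open>Approximating e + c s within 1 by z a^n forces \<open>cmod z \<le> 2\<close>.
      Multiplication by 1 - e then leaves c s = z s^n up to 1 + \<open>norm e\<close>, too little
      for this \<open>c\<close>.\<close>
    then obtain c :: nat where c: "real c * norm s > (1 + norm e) + 2 * M"
      using reals_Archimedean3[of "norm s"] by (meson zero_less_norm_iff)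
    define x where "x = e + real c *\<^sub>R s"
    obtain z n where n: "n \<ge> 1" and lt: "norm (x - sc z (apow a n)) < 1"
      using approx[of 1 x] zero_less_one by metis
    define d where "d = x - sc z (apow a n)"
    have "cmod (1 - z) \<le> 1"
      using scalar[of x n z] sq n lt by (simp add: x_def quasinil_scaleR)
    then have z: "cmod z \<le> 2"
      using norm_triangle_ineq4[of 1 "1 - z"] by simp
    have "d - e * d = real c *\<^sub>R s - sc z (apow s n)"
      by (simp add: d_def x_def spow[OF n] algebra_simps e(1) es mult_sc_right sc_diff_right)
    then have "real c *\<^sub>R s = d - e * d + sc z (apow s n)" by simp
    then have "real c * norm s = norm (d - e * d + sc z (apow s n))"
      by (metis abs_of_nat norm_scaleR)
    also have "\<dots> \<le> norm d + norm e * norm d + cmod z * norm (apow s n)"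
      using norm_triangle_ineq[of "d - e * d" "sc z (apow s n)"] norm_triangle_ineq4[of d "e * d"]
        norm_mult_ineq[of e d] by (simp add: norm_sc)
    also have "\<dots> \<le> 1 + norm e * 1 + 2 * M"
      using lt z M(2)[OF n] M(1) by (intro add_mono mult_mono) (auto simp: d_def)
    finally show False using c by simp
  qed
  then have ea: "e * a = a" by (simp add: s_def)
  have unit: "e * x = x" for x
  proof (rule closed_predicate_holds[of "\<lambda>x. e * x = x"])
    show "closed {x. e * x = x}" by (intro closed_Collect_eq continuous_intros)
    show "e * sc z (apow a n) = sc z (apow a n)" if "n \<ge> 1" for z n
    proof -
      have "apow (0::'a) n = 0" using that by (induction n rule: dec_induct) (auto simp: apow_Suc)
      then show ?thesis using spow[OF that] \<open>s = 0\<close> by (simp add: mult_sc_right)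
    qed
  qed

  define q where "q = a - e"
  have q: "q \<in> quasinil" using quasinil_minus[OF e(2)] by (simp add: q_def)
  \<comment> \<open>As \<open>e\<close> is now a unit and a = e + q, this is the actual power (1 +
    q)^n.\<close>
  have circ: "apow a n = e + circ_pow n q" if "n \<ge> 1" for n
    using that
  proof (induction n rule: dec_induct)
    case base
    show ?case by (simp add: q_def)
  next
    case (step k)
    have "apow a (Suc k) = (e + q) * (e + circ_pow k q)"
      using step by (simp add: apow_Suc q_def)
    also have "\<dots> = e + circ_pow (Suc k) q"
      by (simp add: distrib_left distrib_right unit comm[of q] add_ac)
    finally show ?case .
  qed
  \<comment> \<open>Some power of \<open>a\<close> is close to \<open>e\<close>, hence so is its \<open>n\<close>-th root \<open>a\<close>.\<close>
  have small: "norm q \<le> \<delta>" if \<delta>: "\<delta> > 0" for \<delta>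
  proof -
    \<comment> \<open>The bound 1/2 keeps \<open>z\<close> away from 0 and so bounds
      \<open>apow a n\<close>; the other makes \<open>norm y\<close> at most 1/2 and
      \<delta>/2.\<close>
    define \<epsilon> where "\<epsilon> = min (1/2) (min (1/4) (\<delta> / 4) / (2 * (norm e + 1)))"
    have \<epsilon>: "\<epsilon> > 0" "\<epsilon> \<le> 1/2"
      using \<delta> by (auto simp: \<epsilon>_def add_nonneg_pos)
    have "\<epsilon> \<le> min (1/4) (\<delta> / 4) / (2 * (norm e + 1))" by (simp add: \<epsilon>_def)
    then have \<epsilon>': "2 * (norm e + 1) * \<epsilon> \<le> min (1/4) (\<delta> / 4)"
      by (simp add: pos_le_divide_eq add_nonneg_pos mult.commute)
    obtain z n where n: "n \<ge> 1" and lt: "norm (e - sc z (apow a n)) < \<epsilon>"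
      using approx[OF \<epsilon>(1)] by metis
    have z1: "cmod (1 - z) \<le> \<epsilon>"
      using scalar[of e n z] n lt by simp
    have z2: "cmod z \<ge> 1/2"
      using norm_triangle_ineq[of "1 - z" z] z1 \<epsilon>(2) by simp
    define y where "y = apow a n - e"
    have "norm (sc z (apow a n)) \<le> norm e + 1"
      using norm_triangle_ineq4[of e "e - sc z (apow a n)"] lt \<epsilon>(2) by simp
    then have "cmod z * norm (apow a n) \<le> norm e + 1" by (simp add: norm_sc)
    moreover have "1/2 * norm (apow a n) \<le> cmod z * norm (apow a n)"
      using z2 by (intro mult_right_mono) auto
    ultimately have an: "norm (apow a n) \<le> 2 * (norm e + 1)" by simp
    have "y = sc (1 - z) (apow a n) - (e - sc z (apow a n))"
      by (simp add: y_def sc_diff_left)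
    then have "norm y \<le> cmod (1 - z) * norm (apow a n) + norm (e - sc z (apow a n))"
      using norm_triangle_ineq4 by (metis norm_sc)
    also have "\<dots> \<le> \<epsilon> * (2 * (norm e + 1)) + \<epsilon>"
      using z1 an lt \<epsilon>(1) by (intro add_mono mult_mono) auto
    also have "\<dots> \<le> 2 * (2 * (norm e + 1) * \<epsilon>)"
      using \<epsilon>(1) mult_nonneg_nonneg[of "norm e" \<epsilon>] by (simp add: algebra_simps)
    finally have y: "norm y \<le> 1/2" "2 * norm y \<le> \<delta>" using \<epsilon>' by auto
    have yq: "y \<in> quasinil" using pow[OF n] by (simp add: y_def)
    then have ry: "spectral_radius y < 1" by (simp add: quasinil_def)
    have n1: "\<bar>1 / real n\<bar> \<le> 1" using n by simp
    \<comment> \<open>Both arguments are quasinilpotent n-th roots of e + y, so they agree, and the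
      root inherits the smallness of \<open>y\<close>.\<close>
    have "circ_pow n (binom_series (1 / real n) y) = circ_pow n q"
      using circ_pow_binom_series[OF n ry] circ[OF n] by (simp add: y_def)
    then have "binom_series (1 / real n) y = q"
      by (rule circ_pow_inj[OF binom_series_quasinil[OF n1 yq] q n])
    then show ?thesis
      using norm_binom_series_le[OF n1 y(1)] y(2) by simp
  qed
  have "norm q \<le> 0" by (rule dense_ge) (rule small)
  then have ae: "a = e" by (simp add: q_def)
  have an: "apow a n = a" if "n \<ge> 1" for n
    using that by (induction n rule: dec_induct) (auto simp: apow_Suc ae e(1))
  show ?thesis
  proof (rule cdim_le_1_if_line_dense[of a])
    fix x and \<epsilon> :: real assume "\<epsilon> > 0"
    then show "\<exists>z. norm (x - sc z a) < \<epsilon>"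
      using approx[of \<epsilon> x] an by metis
  qed
qed

lemma all_quasinil:
  assumes "\<not> cdim_le_1 sc"
  shows "x \<in> quasinil"
proof -
  have a: "a \<in> quasinil"
  proof (rule ccontr)
    assume "a \<notin> quasinil"
    then have r: "spectral_radius a > 0"
      by (simp add: quasinil_def order.not_eq_order_implies_strict)
    define b where "b = sc (of_real (1 / spectral_radius a)) a"
    interpret b: supercyclic_element sc b
      unfolding b_def by (rule supercyclic_element_sc) (use r in auto)
    have rb: "spectral_radius b = 1"
      using r by (simp add: b_def spectral_radius_sc norm_divide)
    obtain z where z: "b * b - sc z b \<in> quasinil"
      using b.exists_spectral_value[OF rb] by metis
    have "cmod z = 1"
      using spectral_radius_diff_abs[of "b * b" "sc z b"] z rb
      by (simp add: quasinil_def b.spectral_radius_mult spectral_radius_sc)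
    then have z0: "z \<noteq> 0" by auto
    \<comment> \<open>Dividing by \<open>z\<close> turns b^2 - z b into a multiple of c^2 - c; the
      radius stays 1 as \<open>cmod z = 1\<close>.\<close>
    define c where "c = sc (1 / z) b"
    interpret c: supercyclic_element sc c
      unfolding c_def by (rule b.supercyclic_element_sc) (use z0 in auto)
    have "c * c - c = sc (1 / z * (1 / z)) (b * b - sc z b)"
      using z0 by (simp add: c_def mult_sc_left mult_sc_right sc_sc sc_diff_right)
    then have "c * c - c \<in> quasinil" using z by (simp add: quasinil_sc)
    moreover have "spectral_radius c = 1"
      using \<open>cmod z = 1\<close> rb by (simp add: c_def spectral_radius_sc norm_divide)
    ultimately have "cdim_le_1 sc" by (intro c.cdim_le_1_if_quasi_idempotent)
    with assms show False by simp
  qed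
  have "spectral_radius x = 0"
  proof (rule closed_predicate_holds[of "\<lambda>x. spectral_radius x = 0"])
    show "closed {x :: 'a. spectral_radius x = 0}"
      by (intro closed_Collect_eq continuous_on_spectral_radius continuous_intros)
    show "spectral_radius (sc z (apow a n)) = 0" if "n \<ge> 1" for z n
      using quasinil_sc[OF quasinil_apow[OF a that], of z] by (simp add: quasinil_def)
  qed
  then show ?thesis by (simp add: quasinil_def)
qed

section \<open>Approximation by high powers\<close>

text \<open>In dimension above one a closed line has empty interior, so discarding the multiples of
  \<open>a\<close> preserves density; multiplication by \<open>a\<close> extends this to any number
  of low powers.\<close>

lemma approx_large:
  assumes dim: "\<not> cdim_le_1 sc" and "\<epsilon> > 0"
  obtains z n where "n \<ge> N" "n \<ge> 1" "norm (x - sc z (apow a n)) < \<epsilon>"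
proof -
  define S where "S N = {sc z (apow a n) |z n. n \<ge> N \<and> n \<ge> 1}" for N
  have cl_S1: "x \<in> closure (S 1)" for x
  proof -
    have "S 1 = {sc z (apow a n) |z n. n \<ge> 1}" by (auto simp: S_def)
    then show ?thesis using dense by auto
  qed
  have sc_S: "sc z x \<in> closure (S N)" if "x \<in> closure (S N)" for z x N
  proof -
    have "sc z ` S N \<subseteq> S N" unfolding S_def by (force simp: sc_sc)
    then have "closure (sc z ` S N) \<subseteq> closure (S N)" by (rule closure_mono)
    moreover have "sc z ` closure (S N) \<subseteq> closure (sc z ` S N)"
      by (intro closure_bounded_linear_image_subset bounded_linear_sc_right)
    ultimately show ?thesis using that by blast
  qed
  have a2: "a \<in> closure (S 2)"
  proof -
    obtain w where w: "\<And>z. w \<noteq> sc z a"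
      using dim unfolding cdim_le_1_def by metis
    have "S 1 \<subseteq> range (\<lambda>z. sc z a) \<union> S 2"
    proof
      fix x assume "x \<in> S 1"
      then obtain z n where x: "x = sc z (apow a n)" "n \<ge> 1" by (auto simp: S_def)
      show "x \<in> range (\<lambda>z. sc z a) \<union> S 2"
      proof (cases "n = 1")
        case False
        then have "n \<ge> 2" using x by simp
        then have "x \<in> S 2" using x unfolding S_def by blast
        then show ?thesis by blast
      qed (use x in auto)
    qed
    then have "closure (S 1) \<subseteq> closure (range (\<lambda>z. sc z a)) \<union> closure (S 2)"
      using closure_mono[of "S 1" "range (\<lambda>z. sc z a) \<union> S 2"] by simp
    moreover have "closure (range (\<lambda>z. sc z a)) = range (\<lambda>z. sc z a)"
      by (rule closure_closed[OF closed_line])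
    ultimately have cover: "x \<in> range (\<lambda>z. sc z a) \<or> x \<in> closure (S 2)" for x
      using cl_S1 by blast
    \<comment> \<open>These points lie off the line through \<open>a\<close> because
      \<open>w\<close> does, hence in the closure of \<open>S 2\<close>, and they converge to
      \<open>a\<close>.\<close>
    have "a + (1 / real (Suc k)) *\<^sub>R w \<in> closure (S 2)" for k
    proof (rule ccontr)
      assume "a + (1 / real (Suc k)) *\<^sub>R w \<notin> closure (S 2)"
      then obtain z where "a + (1 / real (Suc k)) *\<^sub>R w = sc z a"
        using cover by blast
      then have "(1 / real (Suc k)) *\<^sub>R w = sc (z - 1) a"
        by (simp add: sc_diff_left algebra_simps)
      then have "real (Suc k) *\<^sub>R ((1 / real (Suc k)) *\<^sub>R w) = sc (of_real (real (Suc k)) * (z - 1)) a"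
        by (simp only: sc_of_real[symmetric] sc_sc)
      then have "w = sc (of_real (real (Suc k)) * (z - 1)) a" by simp
      then show False using w by blast
    qed
    moreover have "(\<lambda>k. a + (1 / real (Suc k)) *\<^sub>R w) \<longlonglongrightarrow> a + 0 *\<^sub>R w"
      by (intro tendsto_intros LIMSEQ_Suc[OF lim_1_over_n])
    ultimately have "a + 0 *\<^sub>R w \<in> closure (S 2)"
      by (rule closed_sequentially[OF closed_closure])
    then show ?thesis by simp
  qed
  have pow: "apow a (Suc k) \<in> closure (S (Suc (Suc k)))" for k
  proof (induction k)
    case 0
    show ?case using a2 by (simp add: numeral_2_eq_2)
  next
    case (Suc k)
    have "(\<lambda>x. a * x) ` S (Suc (Suc k)) \<subseteq> S (Suc (Suc (Suc k)))"
    proof clarify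
      fix x assume "x \<in> S (Suc (Suc k))"
      then obtain z n where "x = sc z (apow a n)" "n \<ge> Suc (Suc k)"
        unfolding S_def by blast
      then have "a * x = sc z (apow a (Suc n))" "Suc n \<ge> Suc (Suc (Suc k))" "1 \<le> Suc n"
        by (simp_all add: mult_sc_right apow_Suc)
      then show "a * x \<in> S (Suc (Suc (Suc k)))"
        unfolding S_def by blast
    qed
    then have "closure ((\<lambda>x. a * x) ` S (Suc (Suc k))) \<subseteq> closure (S (Suc (Suc (Suc k))))"
      by (rule closure_mono)
    moreover have "(\<lambda>x. a * x) ` closure (S (Suc (Suc k))) \<subseteq> closure ((\<lambda>x. a * x) ` S (Suc (Suc k)))"
      by (intro closure_bounded_linear_image_subset bounded_linear_mult_right)
    ultimately show ?case using Suc by (auto simp: apow_Suc)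
  qed
  \<comment> \<open>Powers are discarded one at a time; the multiples of
    \<open>apow a (Suc N)\<close> lost in a step are recovered by \<open>pow\<close>.\<close>
  have "x \<in> closure (S (Suc N))" for x N
  proof (induction N arbitrary: x)
    case 0
    show ?case using cl_S1 by simp
  next
    case (Suc N)
    have "S (Suc N) \<subseteq> closure (S (Suc (Suc N)))"
    proof
      fix x assume "x \<in> S (Suc N)"
      then obtain z n where x: "x = sc z (apow a n)" "n \<ge> Suc N" by (auto simp: S_def)
      show "x \<in> closure (S (Suc (Suc N)))"
      proof (cases "n = Suc N")
        case True
        then show ?thesis using pow[of N] sc_S by (simp add: x)
      next
        case False
        then have "Suc (Suc N) \<le> n" "1 \<le> n" using x by simp_all
        then have "x \<in> S (Suc (Suc N))" using x(1) unfolding S_def by blast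
        then show ?thesis using closure_subset by blast
      qed
    qed
    then have "closure (S (Suc N)) \<subseteq> closure (S (Suc (Suc N)))"
      by (rule closure_minimal) simp
    then show ?case using Suc by blast
  qed
  from this[of x N] obtain y where "y \<in> S (Suc N)" "dist y x < \<epsilon>"
    using assms(2) unfolding closure_approachable by blast
  then obtain z n where "n \<ge> Suc N" "n \<ge> 1" "norm (x - sc z (apow a n)) < \<epsilon>"
    unfolding S_def by (auto simp: dist_norm norm_minus_commute)
  then show ?thesis using that by (metis Suc_leD)
qed

section \<open>The three conclusions\<close>

text \<open>A linear relation among powers expresses some a^n by higher ones, so a^n = a^n w. As
  \<open>w\<close> is quasinilpotent, a^n = 0, which contradicts approximation by high
  powers.\<close>

lemma not_cfinite_dimensional:
  assumes dim: "\<not> cdim_le_1 sc"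
  shows "\<not> cfinite_dimensional sc"
proof
  assume "cfinite_dimensional sc"
  then obtain T where T: "finite T" "cspan sc T = UNIV"
    unfolding cfinite_dimensional_def by blast
  interpret V: vector_space sc
    by unfold_locales (simp_all add: sc_add_right sc_add_left sc_sc)
  have spanT: "x \<in> V.span T" for x
  proof -
    have "x \<in> cspan sc T" by (simp add: T)
    then obtain c where "x = (\<Sum>v\<in>T. sc (c v) v)" by (auto simp: cspan_def)
    then show ?thesis
      by (auto intro: V.span_sum V.span_scale V.span_base)
  qed
  have "\<exists>n\<ge>1. apow a n \<in> V.span {apow a i |i. i > n}"
  proof (rule ccontr)
    assume "\<not> ?thesis"
    then have notin: "apow a n \<notin> V.span {apow a i |i. i > n}" if "n \<ge> 1" for n
      using that by blast
    \<comment> \<open>If no power lies in the span of the later ones, prepending lower powers keeps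
      the family independent, beyond the size of \<open>T\<close>.\<close>
    have "V.independent (apow a ` {n..<n + k}) \<and> card (apow a ` {n..<n + k}) = k" if "n \<ge> 1" for n k
      using that
    proof (induction k arbitrary: n)
      case 0
      show ?case by (simp add: V.independent_empty)
    next
      case (Suc k)
      have eq: "apow a ` {n..<n + Suc k} = insert (apow a n) (apow a ` {Suc n..<Suc n + k})"
        by (subst image_insert[symmetric], rule arg_cong[of _ _ "image (apow a)"]) auto
      have "apow a ` {Suc n..<Suc n + k} \<subseteq> {apow a i |i. i > n}" by auto
      then have ni: "apow a n \<notin> V.span (apow a ` {Suc n..<Suc n + k})"
        using notin[OF Suc.prems] V.span_mono by blast
      then have "apow a n \<notin> apow a ` {Suc n..<Suc n + k}"
        using V.span_base by blast
      then show ?case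
        using Suc.IH[of "Suc n"] ni unfolding eq by (simp add: V.independent_insert)
    qed
    from this[of 1 "Suc (card T)"]
    have "V.independent (apow a ` {1..<1 + Suc (card T)})"
      "card (apow a ` {1..<1 + Suc (card T)}) = Suc (card T)" by auto
    then show False
      using V.independent_span_bound[OF T(1), of "apow a ` {1..<1 + Suc (card T)}"] spanT by auto
  qed
  then obtain n where n: "n \<ge> 1" "apow a n \<in> V.span {apow a i |i. i > n}" by blast
  have "V.span {apow a i |i. i > n} \<subseteq> range (\<lambda>w. apow a n * w)"
  proof (rule V.span_minimal)
    show "{apow a i |i. i > n} \<subseteq> range (\<lambda>w. apow a n * w)"
    proof clarify
      fix i assume "n < i"
      then have "apow a i = apow a n * apow a (i - n)" using n(1) by (simp add: apow_add)
      then show "apow a i \<in> range (\<lambda>w. apow a n * w)" by blast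
    qed
    show "V.subspace (range (\<lambda>w. apow a n * w))"
      unfolding V.subspace_def
      by (auto simp: image_iff intro: exI[of _ 0] distrib_left[symmetric] mult_sc_right[symmetric])
  qed
  then obtain w where w: "apow a n = apow a n * w" using n(2) by blast
  have "spectral_radius w = 0" using all_quasinil[OF dim, of w] by (simp add: quasinil_def)
  then have an: "apow a n = 0"
    using w comm by (rule eq_0_if_quasinilpotent_eigen)
  have am: "apow a m = 0" if "m \<ge> n" for m
    using that n(1)
  proof (induction m rule: dec_induct)
    case (step k)
    then show ?case by (simp add: apow_Suc)
  qed (simp add: an)
  have "cdim_le_1 sc"
  proof (rule cdim_le_1_if_line_dense[of a])
    fix x and \<epsilon> :: real assume "\<epsilon> > 0"
    then obtain z m where "m \<ge> n" "norm (x - sc z (apow a m)) < \<epsilon>"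
      using approx_large[OF dim] by metis
    then show "\<exists>z. norm (x - sc z a) < \<epsilon>"
      by (intro exI[of _ 0]) (simp add: am)
  qed
  with dim show False by simp
qed

text \<open>A modular unit \<open>u\<close> of \<open>L\<close> is quasinilpotent and has the
  quasi-inverse b = (1 - u)^(-1) - 1. Then u = b - b u lies in \<open>L\<close>, which is therefore
  everything.\<close>

lemma radical:
  assumes "\<not> cdim_le_1 sc"
  shows "radical_algebra sc"
proof -
  have "\<not> maximal_modular_left_ideal sc L" for L
  proof
    assume L: "maximal_modular_left_ideal sc L"
    then obtain u where u: "\<And>x. x - x * u \<in> L" and LI: "left_ideal sc L" and "L \<noteq> UNIV"
      unfolding maximal_modular_left_ideal_def modular_left_ideal_def by blast
    have "spectral_radius (- u) < 1"
      using all_quasinil[OF assms, of "- u"] by (simp add: quasinil_def)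
    then have "binom_series (-1) (- u) * (- u) = - binom_series (-1) (- u) + u"
      using binom_series_mult[of "-1" 1 "- u"] by simp
    then have "u = binom_series (-1) (- u) - binom_series (-1) (- u) * u"
      by (simp add: algebra_simps)
    then have "u \<in> L" using u by metis
    then have "x * u \<in> L" for x using LI by (simp add: left_ideal_def)
    then have "x \<in> L" for x
      using u[of x] LI unfolding left_ideal_def by (metis diff_add_cancel)
    with \<open>L \<noteq> UNIV\<close> show False by blast
  qed
  then show ?thesis by (simp add: radical_algebra_def jacobson_radical_def)
qed

text \<open>\<open>D(a\<^sup>n)(a\<^sup>m) = n D(a)(a\<^sup>n\<^sup>+\<^sup>m\<^sup>-\<^sup>1)\<close>, hence \<open>m D(a\<^sup>n)(a\<^sup>m) = n D(a\<^sup>m)(a\<^sup>n)\<close>; letting \<open>n\<close> tend to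
  infinity along approximations \<open>z a\<^sup>n\<close> of \<open>x\<close> gives \<open>D(a\<^sup>m)(x) = 0\<close>.\<close>

lemma derivation_zero:
  assumes dim: "\<not> cdim_le_1 sc" and D: "continuous_derivation_dual sc D"
  shows "D x y = 0"
proof -
  have D_elem: "dual_elem sc (D u)"
    and D_add: "D (u + v) = (\<lambda>x. D u x + D v x)"
    and D_sc: "D (sc z u) = (\<lambda>x. z * D u x)"
    and D_mult: "D (u * v) x = D u (v * x) + D v (x * u)" for u v x z
    using D unfolding continuous_derivation_dual_def by blast+
  have D_sc2: "D u (sc z x) = z * D u x" and D_add2: "D u (x + y) = D u x + D u y" for u z x y
    using D_elem[of u] unfolding dual_elem_def by blast+
  obtain K where K: "\<And>u x. cmod (D u x) \<le> K * norm u * norm x"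
    using D unfolding continuous_derivation_dual_def by blast
  have D_diff2: "D u (x - y) = D u x - D u y" for u x y
    using D_add2[of u "x - y" y] by simp
  have pow: "D (apow a n) (apow a m) = of_nat n * D a (apow a (n + m - 1))"
    if "n \<ge> 1" "m \<ge> 1" for n m
    using that
  proof (induction n arbitrary: m rule: dec_induct)
    case base
    then show ?case by simp
  next
    case (step k)
    have "D (apow a (Suc k)) (apow a m) = D a (apow a k * apow a m) + D (apow a k) (apow a m * a)"
      using step by (simp add: apow_Suc D_mult)
    also have "apow a m * a = apow a (Suc m)"
      using step by (simp add: apow_Suc comm)
    also have "D (apow a k) (apow a (Suc m)) = of_nat k * D a (apow a (k + Suc m - 1))"
      using step.IH[of "Suc m"] by simp
    also have "apow a k * apow a m = apow a (k + m)" using step by (simp add: apow_add)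
    finally show ?case by (simp add: algebra_simps)
  qed
  have swap: "of_nat m * D (apow a n) (apow a m) = of_nat n * D (apow a m) (apow a n)"
    if "n \<ge> 1" "m \<ge> 1" for n m
    using pow[OF that] pow[OF that(2,1)] by (simp add: add.commute)
  have zero: "D (apow a m) x = 0" if m: "m \<ge> 1" for m x
  proof -
    \<comment> \<open>The first summand bounds m D(u)(a^m), which equals n D(a^m)(u) for u = z a^n;
      the second bounds the error at x - u. The absolute value covers a negative
      \<open>K\<close>.\<close>
    define B where "B = real m * \<bar>K\<bar> * (norm x + 1) * norm (apow a m) + \<bar>K\<bar> * norm (apow a m)"
    have "cmod (D (apow a m) x) \<le> B * (1 / real (Suc N))" for N
    proof -
      have "1 / real (Suc N) > 0" by simp
      then obtain z n where n: "n \<ge> Suc N" "n \<ge> 1"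
        and lt: "norm (x - sc z (apow a n)) < 1 / real (Suc N)"
        using approx_large[OF dim] by metis
      define u where "u = sc z (apow a n)"
      have "norm u \<le> norm x + norm (x - u)"
        using norm_triangle_ineq4[of x "x - u"] by simp
      also have "\<dots> \<le> norm x + 1"
        using lt unfolding u_def by (simp add: less_imp_le order_trans[OF less_imp_le[OF lt]])
      finally have nu: "norm u \<le> norm x + 1" .
      have "of_nat n * D (apow a m) u = of_nat m * D u (apow a m)"
        using swap[OF n(2) m] by (simp add: u_def D_sc D_sc2 mult.left_commute)
      then have "real n * cmod (D (apow a m) u) = real m * cmod (D u (apow a m))"
        by (metis norm_mult norm_of_nat)
      also have "\<dots> \<le> real m * (\<bar>K\<bar> * (norm x + 1) * norm (apow a m))"
      proof (rule mult_left_mono)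
        have "cmod (D u (apow a m)) \<le> K * norm u * norm (apow a m)" by (rule K)
        also have "\<dots> \<le> \<bar>K\<bar> * (norm x + 1) * norm (apow a m)"
          using nu by (intro mult_right_mono mult_mono) auto
        finally show "cmod (D u (apow a m)) \<le> \<bar>K\<bar> * (norm x + 1) * norm (apow a m)" .
      qed simp
      finally have "real n * cmod (D (apow a m) u) \<le> real m * (\<bar>K\<bar> * (norm x + 1) * norm (apow a m))" .
      moreover have "real (Suc N) * cmod (D (apow a m) u) \<le> real n * cmod (D (apow a m) u)"
        using n by (intro mult_right_mono) auto
      ultimately have 1: "cmod (D (apow a m) u) \<le> real m * (\<bar>K\<bar> * (norm x + 1) * norm (apow a m)) * (1 / real (Suc N))"
        by (simp add: pos_le_divide_eq mult.commute)
      have "cmod (D (apow a m) (x - u)) \<le> K * norm (apow a m) * norm (x - u)" by (rule K)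
      also have "\<dots> \<le> \<bar>K\<bar> * norm (apow a m) * (1 / real (Suc N))"
        using lt by (intro mult_mono mult_right_mono) (auto simp: u_def)
      finally have 2: "cmod (D (apow a m) (x - u)) \<le> \<bar>K\<bar> * norm (apow a m) * (1 / real (Suc N))" .
      have "cmod (D (apow a m) x) \<le> cmod (D (apow a m) u) + cmod (D (apow a m) (x - u))"
        using norm_triangle_ineq[of "D (apow a m) u" "D (apow a m) (x - u)"] by (simp add: D_diff2)
      with 1 2 show ?thesis unfolding B_def distrib_right by (simp add: mult.assoc)
    qed
    moreover have "(\<lambda>N. B * (1 / real (Suc N))) \<longlonglongrightarrow> B * 0"
      by (intro tendsto_intros LIMSEQ_Suc[OF lim_1_over_n])
    ultimately have "cmod (D (apow a m) x) \<le> B * 0"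
      by (intro LIMSEQ_le_const) auto
    then show ?thesis by simp
  qed
  show ?thesis
  proof (rule closed_predicate_holds[of "\<lambda>x. D x y = 0"])
    have "bounded_linear (\<lambda>x. D x y)"
    proof (rule bounded_linear_intro[of _ "K * norm y"])
      fix r x
      show "D (scaleR r x) y = scaleR r (D x y)"
        using D_sc[of "of_real r" x] by (simp add: sc_of_real scaleR_conv_of_real)
      show "norm (D x y) \<le> norm x * (K * norm y)" using K[of x y] by (simp add: mult_ac)
    qed (simp add: D_add)
    then show "closed {x. D x y = 0}"
      by (intro closed_Collect_eq continuous_intros linear_continuous_on)
  qed (simp add: D_sc zero)
qed

text \<open>Every continuous derivation is zero and so is implemented by the zero
  functional.\<close>

lemma weakly_amenable:
  assumes "\<not> cdim_le_1 sc"
  shows "weakly_amenable sc"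
  unfolding weakly_amenable_def
proof (intro allI impI)
  fix D assume "continuous_derivation_dual sc D"
  then have "D x y = 0" for x y using derivation_zero[OF assms] by blast
  moreover have "dual_elem sc (\<lambda>_. 0)" by (auto simp: dual_elem_def intro: exI[of _ 0])
  ultimately show "\<exists>f. dual_elem sc f \<and> (\<forall>a x. D a x = f (x * a) - f (a * x))"
    by (intro exI[of _ "\<lambda>_. 0"]) auto
qed

end

theorem theorem1p3:
  fixes sc :: "complex \<Rightarrow> 'a::{real_normed_algebra,banach} \<Rightarrow> 'a"
  assumes "complex_banach_algebra sc"
    and "supercyclic sc"
    and "\<not> cdim_le_1 sc"
  shows "\<not> cfinite_dimensional sc \<and> radical_algebra sc \<and> weakly_amenable sc"
proof -
  obtain a where "closure {sc z (apow a n) |z n. n \<ge> 1} = UNIV"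
    using assms(2) unfolding supercyclic_def by blast
  then interpret supercyclic_element sc a
    using assms(1) by unfold_locales
  show ?thesis
    using assms(3) not_cfinite_dimensional radical weakly_amenable by blast
qed

end
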